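(* There is an absolute constant $\mathcal{C}>0$ such that the following holds. Let $A\subseteq\mathbb{R}$ be a finite set, let $s\ge2$ be an integer and suppose $E_s(A)=|A|^{2s-1}/K$ for some $K\ge1$. Then there exist an integer $2\le s'\le s$ and a finite non-empty set $U'\subseteq s'A$ satisfying \[ |U'|\ll K|A|\quad\text{and}\quad\max_{x\in U'-A}|(A+x)\cap U'|\gg\frac{|A|}{K^{\mathcal{C}/\log s}} \] such that for every $m,n\in\mathbb{N}\cup\{0\}$, \[ |mU'-nU'|\ll_{m,n}K^{\mathcal{C}(m+n)/\log s}|U'|. \]
   Context: $E_s(A)$ is the number of $(a_1,\dots,a_{2s})\in A^{2s}$ with $a_1+\dots+a_s=a_{s+1}+\dots+a_{2s}$. For $k\in\mathbb{N}$, $kA=\{a_1+\dots+a_k:a_i\in A\}$; $mU'-nU'=\{u_1+\dots+u_m-u'_1-\dots-u'_n:u_i,u'_j\in U'\}$; $U'-A=\{u-a\}$, $A+x=\{a+x:a\in A\}$. Logarithms are to base 2. $\ll$ without subscript means up to an absolute constant; $\ll_{m,n}$ up to a constant depending only on $m,n$. *)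

theory Defs
  imports Complex_Main "HOL-Library.FuncSet"
begin

text \<open>\<open>E\<^sub>s(A)\<close>: the \<open>2s\<close>-tuples are indexed by \<open>{..<2 * s}\<close>; extensional functions are used so
  that each tuple is counted exactly once.\<close>

definition energy :: "nat \<Rightarrow> real set \<Rightarrow> nat" where
  "energy s A = card {a \<in> {..<2 * s} \<rightarrow>\<^sub>E A. (\<Sum>i<s. a i) = (\<Sum>i=s..<2 * s. a i)}"

definition sumset :: "nat \<Rightarrow> real set \<Rightarrow> real set" where
  "sumset k A = {\<Sum>i<k. a i | a. \<forall>i<k. a i \<in> A}"

definition sumdiffset :: "nat \<Rightarrow> nat \<Rightarrow> real set \<Rightarrow> real set" where
  "sumdiffset m n U =
    {(\<Sum>i<m. u i) - (\<Sum>j<n. v j) | u v. (\<forall>i<m. u i \<in> U) \<and> (\<forall>j<n. v j \<in> U)}"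

text \<open>\<open>U - A\<close> in the additive sense; the library's minus on sets is the set-theoretic difference.\<close>

definition diffset :: "real set \<Rightarrow> real set \<Rightarrow> real set" where
  "diffset U A = {u - a | u a. u \<in> U \<and> a \<in> A}"

definition translate :: "real set \<Rightarrow> real \<Rightarrow> real set" where
  "translate A x = (\<lambda>a. a + x) ` A"

end

theory Submission
  imports Defs "HOL-Library.Set_Algebras" "HOL-Analysis.Convex"
begin

text \<open>
  Let \<open>\<mu>\<close> be the uniform probability measure on \<open>A\<close>. The squared \<open>L\<^sup>2\<close> norms of the convolution powers
  \<open>\<mu>\<^sup>k\<close> at the exponents \<open>k = 1, 2, 4, 8, ...\<close> decrease from \<open>1 / |A|\<close> and stay above \<open>1 / (K |A|)\<close> as long as the exponent
  is at most \<open>s\<close>. Hence some doubling step \<open>k \<rightarrow> 2k \<le> s\<close> loses at most a factor \<open>L = K powr (1 / t)\<close>, where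
  \<open>t = \<lfloor>log 2 s\<rfloor>\<close>. For such a \<open>k\<close>, the level set on which \<open>\<mu>\<^sup>k\<close> is comparable to its squared \<open>L\<^sup>2\<close> norm \<open>Q\<close>
  (up to powers of \<open>L\<close>) has additive energy at least a power of \<open>1 / L\<close> times the maximum, and the
  Balog--Szemeredi--Gowers theorem gives a subset \<open>V\<close> of size about \<open>1 / Q \<le> K |A|\<close> with \<open>|V - V|\<close> at most a
  power of \<open>L\<close> times \<open>|V|\<close>. Pluennecke's inequality, in Petridis' form, bounds \<open>mV - nV\<close>. Finally
  \<open>\<mu>\<^sup>k(V)\<close> is an average of \<open>|(A + y) \<inter> V| / |A|\<close> over \<open>y\<close> and is at least a power of \<open>1 / L\<close>, so some
  translate of \<open>A\<close> meets \<open>V\<close> in a large set.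
\<close>

section \<open>Sumset growth\<close>

text \<open>Induction on \<open>C\<close>. When \<open>c\<close> joins \<open>C\<close>, let
  \<open>c + Z\<close> be the part of \<open>c + X\<close> already inside \<open>C + X\<close>. Then
  \<open>C + X\<close> gains exactly |X| - |Z| points, while \<open>C + X + W\<close> already
  contains \<open>c + Z + W\<close> and so gains at most |X + W| - |Z + W|. Minimality of the ratio
  |X + W| / |X| among subsets of \<open>X\<close>, cross-multiplied to include the empty set,
  compares the two gains.\<close>

lemma petridis:
  fixes X W C :: "'a::ab_group_add set"
  assumes fX: "finite X" and fW: "finite W" and fC: "finite C"
    and minimal: "\<And>Z. Z \<subseteq> X \<Longrightarrow> card (X + W) * card Z \<le> card (Z + W) * card X"
  shows "card (C + X + W) * card X \<le> card (X + W) * card (C + X)"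
  using fC
proof (induction C rule: finite_induct)
  case empty
  show ?case by (simp add: set_plus_def)
next
  case (insert c C)
  define Z where "Z = {x \<in> X. c + x \<in> C + X}"
  have ZX: "Z \<subseteq> X" by (auto simp: Z_def)
  have fZ: "finite Z" using ZX fX finite_subset by blast
  have fCX: "finite (C + X)" using insert fX by (simp add: finite_set_plus)
  have eq: "insert c C + X = (C + X) \<union> (+) c ` (X - Z)"
    by (auto simp: Z_def set_plus_def)
  have "card (insert c C + X) = card (C + X) + card ((+) c ` (X - Z))"
    unfolding eq by (rule card_Un_disjoint) (use fCX fX in \<open>auto simp: Z_def\<close>)
  also have "card ((+) c ` (X - Z)) = card X - card Z"
    by (simp add: card_image card_Diff_subset fZ ZX)
  finally have c1: "card (insert c C + X) = card (C + X) + (card X - card Z)" .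
  have ZW: "Z + W \<subseteq> X + W" using ZX by (auto simp: set_plus_def)
  have sub: "insert c C + X + W \<subseteq> (C + X + W) \<union> (+) c ` ((X + W) - (Z + W))"
  proof
    fix y assume "y \<in> insert c C + X + W"
    then obtain d x w where y: "y = d + x + w" "d \<in> insert c C" "x \<in> X" "w \<in> W"
      by (auto elim!: set_plus_elim)
    show "y \<in> (C + X + W) \<union> (+) c ` ((X + W) - (Z + W))"
    proof (cases "d \<in> C")
      case True
      then show ?thesis using y by (auto intro!: set_plus_intro)
    next
      case False
      then have d: "d = c" using y by auto
      show ?thesis
      proof (cases "x + w \<in> Z + W")
        case True
        then obtain z v where zv: "x + w = z + v" "z \<in> Z" "v \<in> W" by (auto elim!: set_plus_elim)
        have "y = (c + z) + v" using y d zv by (simp add: add.assoc)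
        moreover have "c + z \<in> C + X" using zv by (auto simp: Z_def)
        ultimately show ?thesis using zv by (auto intro!: set_plus_intro)
      next
        case False
        then have "x + w \<in> (X + W) - (Z + W)" using y by (simp add: set_plus_intro)
        moreover have "y = c + (x + w)" using y d by (simp add: add.assoc)
        ultimately have "y \<in> (+) c ` ((X + W) - (Z + W))" by blast
        then show ?thesis by blast
      qed
    qed
  qed
  have "card (insert c C + X + W) \<le> card ((C + X + W) \<union> (+) c ` ((X + W) - (Z + W)))"
    by (rule card_mono[OF _ sub]) (use insert fX fW in \<open>simp add: finite_set_plus\<close>)
  also have "\<dots> \<le> card (C + X + W) + card ((+) c ` ((X + W) - (Z + W)))"
    by (rule card_Un_le)
  also have "card ((+) c ` ((X + W) - (Z + W))) = card (X + W) - card (Z + W)"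
    by (simp add: card_image card_Diff_subset fZ ZW fW finite_set_plus)
  finally have c2: "card (insert c C + X + W) \<le> card (C + X + W) + (card (X + W) - card (Z + W))" .
  have le1: "card (Z + W) \<le> card (X + W)" by (rule card_mono) (use ZW fX fW in \<open>auto simp: finite_set_plus\<close>)
  have le2: "card Z \<le> card X" by (rule card_mono) (use ZX fX in auto)
  have "card (insert c C + X + W) * card X
      \<le> card (C + X + W) * card X + (card (X + W) - card (Z + W)) * card X"
    using mult_le_mono1[OF c2] by (simp add: add_mult_distrib)
  also have "\<dots> \<le> card (X + W) * card (C + X) + (card (X + W) * card X - card (X + W) * card Z)"
    using insert.IH minimal[OF ZX] by (simp add: diff_mult_distrib)
  also have "\<dots> = card (X + W) * card (insert c C + X)"
    unfolding c1 by (simp add: add_mult_distrib2 diff_mult_distrib2)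
  finally show ?case .
qed

lemma sumset_0 [simp]: "sumset 0 A = {0}"
  by (auto simp: sumset_def)

lemma sumset_Suc: "sumset (Suc k) A = sumset k A + A"
proof
  show "sumset (Suc k) A \<subseteq> sumset k A + A"
    by (fastforce simp: sumset_def intro!: set_plus_intro)
  show "sumset k A + A \<subseteq> sumset (Suc k) A"
  proof
    fix y assume "y \<in> sumset k A + A"
    then obtain a b where ab: "\<forall>i<k. a i \<in> A" "b \<in> A" "y = (\<Sum>i<k. a i) + b"
      by (auto simp: sumset_def elim!: set_plus_elim)
    have "y = (\<Sum>i<Suc k. (a(k := b)) i)" using ab by simp
    moreover have "\<forall>i<Suc k. (a(k := b)) i \<in> A" using ab by (auto simp: less_Suc_eq)
    ultimately show "y \<in> sumset (Suc k) A" unfolding sumset_def by blast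
  qed
qed

lemma finite_sumset: "finite A \<Longrightarrow> finite (sumset k A)"
  by (induction k) (auto simp: sumset_Suc finite_set_plus)

lemma uminus_mem_sumset: "y \<in> sumset k A \<Longrightarrow> - y \<in> sumset k (uminus ` A)"
proof (induction k arbitrary: y)
  case (Suc k)
  then obtain u a where "y = u + a" "u \<in> sumset k A" "a \<in> A"
    by (auto simp: sumset_Suc elim!: set_plus_elim)
  then have "- y = - u + - a" "- u \<in> sumset k (uminus ` A)" using Suc.IH by auto
  then show ?case using \<open>a \<in> A\<close> unfolding sumset_Suc by (metis imageI set_plus_intro)
qed simp

lemma sumdiffset_eq: "sumdiffset m n U = {y - z | y z. y \<in> sumset m U \<and> z \<in> sumset n U}"
  unfolding sumdiffset_def sumset_def by blast

text \<open>The Ruzsa triangle inequality for the pair \<open>mU\<close>, \<open>nU\<close> with pivot \<open>-X\<close>.\<close>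

lemma card_sumdiffset_le:
  assumes fX: "finite X" and fU: "finite U"
  shows "card X * card (sumdiffset m n U)
    \<le> card (X + sumset m (uminus ` U)) * card (X + sumset n (uminus ` U))"
proof -
  have "\<forall>d\<in>sumdiffset m n U. \<exists>y z. d = y - z \<and> y \<in> sumset m U \<and> z \<in> sumset n U"
    by (auto simp: sumdiffset_eq)
  then obtain y z where yz: "\<And>d. d \<in> sumdiffset m n U \<Longrightarrow> d = y d - z d \<and> y d \<in> sumset m U \<and> z d \<in> sumset n U"
    by metis
  \<comment> \<open>The second coordinate minus the first is \<open>y d - z d = d\<close>, so the
    pair determines \<open>d\<close> and then \<open>x\<close>.\<close>
  have "inj_on (\<lambda>(x, d). (x + - y d, x + - z d)) (X \<times> sumdiffset m n U)"
  proof (rule inj_onI, clarify)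
    fix x d x' d'
    assume d: "d \<in> sumdiffset m n U" "d' \<in> sumdiffset m n U"
      and eq: "x + - y d = x' + - y d'" "x + - z d = x' + - z d'"
    have "d = (x + - z d) - (x + - y d)" "d' = (x' + - z d') - (x' + - y d')"
      using yz[OF d(1)] yz[OF d(2)] by auto
    then have "d = d'" using eq by simp
    then show "x = x' \<and> d = d'" using eq by simp
  qed
  moreover have "(\<lambda>(x, d). (x + - y d, x + - z d)) ` (X \<times> sumdiffset m n U)
      \<subseteq> (X + sumset m (uminus ` U)) \<times> (X + sumset n (uminus ` U))"
    using yz by (auto intro!: set_plus_intro uminus_mem_sumset simp del: add_uminus_conv_diff)
  moreover have "finite ((X + sumset m (uminus ` U)) \<times> (X + sumset n (uminus ` U)))"
    using fX fU by (simp add: finite_set_plus finite_sumset)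
  ultimately have "card (X \<times> sumdiffset m n U)
      \<le> card ((X + sumset m (uminus ` U)) \<times> (X + sumset n (uminus ` U)))"
    by (rule card_inj_on_le)
  then show ?thesis by (simp add: card_cartesian_product)
qed

text \<open>With \<open>W\<close> = -U, take the nonempty \<open>X\<close> inside \<open>U\<close>
  minimising |X + W| / |X|; comparison with \<open>U\<close> itself bounds this ratio by
  \<open>D\<close>. Iterating \<open>petridis\<close> gives |X + kW| \<le> D^k |X|, and
  \<open>card_sumdiffset_le\<close> merges the bounds for k = m and k = n.\<close>

lemma pluennecke_ruzsa:
  fixes U :: "real set" and D :: real
  assumes fU: "finite U" and ne: "U \<noteq> {}"
    and D: "real (card (U + uminus ` U)) \<le> D * real (card U)"
  shows "real (card (sumdiffset m n U)) \<le> D ^ (m + n) * real (card U)"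
proof -
  define W where "W = uminus ` U"
  have fW: "finite W" using fU by (simp add: W_def)
  define \<rho> where "\<rho> X = real (card (X + W)) / real (card X)" for X
  have "finite (Pow U - {{}})" "Pow U - {{}} \<noteq> {}" using fU ne by auto
  then obtain X where X: "X \<in> Pow U - {{}}" and Xmin: "\<And>Z. Z \<in> Pow U - {{}} \<Longrightarrow> \<rho> X \<le> \<rho> Z"
    using arg_min_if_finite[of "Pow U - {{}}" \<rho>] by (metis linorder_not_le)
  have XU: "X \<subseteq> U" and Xne: "X \<noteq> {}" using X by auto
  have fX: "finite X" using XU fU finite_subset by blast
  have X0: "real (card X) > 0" using fX Xne by (simp add: card_gt_0_iff)
  have U0: "real (card U) > 0" using fU ne by (simp add: card_gt_0_iff)
  have "\<rho> X \<le> \<rho> U" using Xmin ne by auto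
  also have "\<dots> \<le> D" using D U0 by (simp add: \<rho>_def W_def field_simps)
  finally have rD: "\<rho> X \<le> D" .
  have D0: "0 \<le> D" using rD by (rule order_trans[rotated]) (simp add: \<rho>_def)
  have minimal: "card (X + W) * card Z \<le> card (Z + W) * card X" if "Z \<subseteq> X" for Z
  proof (cases "Z = {}")
    case False
    have "finite Z" using that fX finite_subset by blast
    then have Z0: "real (card Z) > 0" using False by (simp add: card_gt_0_iff)
    have "\<rho> X \<le> \<rho> Z" using Xmin that XU False by auto
    then have "real (card (X + W)) * real (card Z) \<le> real (card (Z + W)) * real (card X)"
      using X0 Z0 by (simp add: \<rho>_def field_simps)
    then show ?thesis by (metis of_nat_le_iff of_nat_mult)
  qed simp
  have growth: "real (card (X + sumset k W)) \<le> D ^ k * real (card X)" for k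
  proof (induction k)
    case (Suc k)
    have "card (sumset k W + X + W) * card X \<le> card (X + W) * card (sumset k W + X)"
      by (rule petridis[OF fX fW finite_sumset[OF fW] minimal])
    then have "real (card (sumset k W + X + W)) * real (card X) \<le> real (card (X + W)) * real (card (sumset k W + X))"
      by (metis of_nat_le_iff of_nat_mult)
    then have "real (card (sumset k W + X + W)) \<le> \<rho> X * real (card (sumset k W + X))"
      using X0 by (simp add: \<rho>_def field_simps)
    also have "\<dots> \<le> D * (D ^ k * real (card X))"
      using rD D0 Suc.IH by (intro mult_mono) (auto simp: add.commute)
    finally show ?case by (simp add: sumset_Suc ac_simps)
  qed simp
  have "real (card X) * real (card (sumdiffset m n U))
      \<le> real (card (X + sumset m W)) * real (card (X + sumset n W))"
    using card_sumdiffset_le[OF fX fU, of m n] unfolding W_def by (metis of_nat_le_iff of_nat_mult)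
  also have "\<dots> \<le> (D ^ m * real (card X)) * (D ^ n * real (card X))"
    by (intro mult_mono growth) (use D0 in auto)
  finally have "real (card (sumdiffset m n U)) \<le> D ^ (m + n) * real (card X)"
    using X0 by (simp add: power_add field_simps)
  also have "\<dots> \<le> D ^ (m + n) * real (card U)"
    using D0 XU fU by (intro mult_left_mono) (auto intro: card_mono)
  finally show ?thesis .
qed

section \<open>The Balog--Szemeredi--Gowers theorem\<close>

text \<open>The hypothesis bounds the additive energy of \<open>U\<close> from below. An averaging
  argument picks a popular difference \<open>s\<close> for which few pairs in \<open>B s\<close>,
  the intersection of \<open>U\<close> and \<open>U + s\<close>, have an unpopular difference;
  \<open>V\<close> keeps the elements of \<open>B s\<close> lying in few such pairs. Any two
  elements of \<open>V\<close> then share at least half of \<open>B s\<close> as good intermediate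
  points, so every element of V - V has many representations by quadruples from
  \<open>U\<close>.\<close>

lemma balog_szemeredi_gowers_diff:
  fixes U :: "'a::ab_group_add set" and \<kappa> :: real
  assumes fU: "finite U" and ne: "U \<noteq> {}" and \<kappa>: "\<kappa> > 0"
    and E: "(\<Sum>a\<in>U. \<Sum>c\<in>U. real (card {b \<in> U. b - (a - c) \<in> U})) \<ge> \<kappa> * real (card U) ^ 3"
  obtains V where "V \<subseteq> U" "real (card V) \<ge> \<kappa> * real (card U) / 4"
    "real (card (V + uminus ` V)) \<le> 1024 / \<kappa> ^ 3 * real (card U)"
proof -
  define u where "u = real (card U)"
  have u0: "u > 0" using fU ne by (simp add: u_def card_gt_0_iff)
  define B where "B x = {b \<in> U. b - x \<in> U}" for x
  define r where "r x = real (card (B x))" for x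
  define D where "D = (\<lambda>(a, c). a - c) ` (U \<times> U)"
  \<comment> \<open>With this threshold the unpopular pairs number at most
    \<open>u\<^sup>2 * \<tau>\<close>, one eighth of the lower bound
    \<open>\<kappa> * u ^ 3 / 2\<close> obtained in \<open>popular\<close>.\<close>
  define \<tau> where "\<tau> = \<kappa> * u / 16"
  have \<tau>0: "\<tau> > 0" using \<kappa> u0 by (simp add: \<tau>_def)
  have fB: "finite (B x)" for x using fU by (simp add: B_def)
  have r0: "r x \<ge> 0" for x by (simp add: r_def)
  have fD: "finite D" using fU by (simp add: D_def)
  have fibre: "real (card {p \<in> U \<times> U. (\<lambda>(a, c). a - c) p = x}) = r x" for x
  proof -
    have "bij_betw (\<lambda>b. (b, b - x)) (B x) {p \<in> U \<times> U. (\<lambda>(a, c). a - c) p = x}"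
      by (rule bij_betwI[where g = fst]) (auto simp: B_def algebra_simps)
    from bij_betw_same_card[OF this] show ?thesis by (simp add: r_def)
  qed
  have pushforward: "(\<Sum>a\<in>U. \<Sum>c\<in>U. \<phi> (a - c)) = (\<Sum>x\<in>D. r x * \<phi> x)" for \<phi> :: "'a \<Rightarrow> real"
  proof -
    have "(\<Sum>a\<in>U. \<Sum>c\<in>U. \<phi> (a - c)) = (\<Sum>p\<in>U \<times> U. \<phi> ((\<lambda>(a, c). a - c) p))"
      by (simp add: sum.cartesian_product case_prod_unfold)
    also have "\<dots> = (\<Sum>x\<in>D. \<Sum>p\<in>{p \<in> U \<times> U. (\<lambda>(a, c). a - c) p = x}. \<phi> ((\<lambda>(a, c). a - c) p))"
      by (rule sum.group[symmetric]) (use fU fD in \<open>auto simp: D_def\<close>)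
    also have "\<dots> = (\<Sum>x\<in>D. \<Sum>p\<in>{p \<in> U \<times> U. (\<lambda>(a, c). a - c) p = x}. \<phi> x)"
      by (intro sum.cong) auto
    also have "\<dots> = (\<Sum>x\<in>D. r x * \<phi> x)" by (simp add: fibre)
    finally show ?thesis .
  qed
  have sum_r: "(\<Sum>x\<in>D. r x) = u\<^sup>2"
    using pushforward[of "\<lambda>_. 1"] by (simp add: u_def power2_eq_square)
  have sum_r2: "(\<Sum>x\<in>D. (r x)\<^sup>2) \<ge> \<kappa> * u ^ 3"
    using E pushforward[of r] by (simp add: r_def B_def u_def power2_eq_square)

  \<comment> \<open>Differences below this threshold carry at most half of the energy. Keeping only
    the others ensures that the chosen \<open>B s\<close> is large.\<close>
  define D' where "D' = {x \<in> D. r x \<ge> \<kappa> * u / 2}"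
  have "(\<Sum>x\<in>D - D'. (r x)\<^sup>2) \<le> (\<Sum>x\<in>D - D'. \<kappa> * u / 2 * r x)"
  proof (rule sum_mono)
    fix x assume "x \<in> D - D'"
    then have "r x \<le> \<kappa> * u / 2" by (auto simp: D'_def)
    then show "(r x)\<^sup>2 \<le> \<kappa> * u / 2 * r x"
      unfolding power2_eq_square by (rule mult_right_mono) (rule r0)
  qed
  also have "\<dots> = \<kappa> * u / 2 * (\<Sum>x\<in>D - D'. r x)" by (simp add: sum_distrib_left)
  also have "\<dots> \<le> \<kappa> * u / 2 * u\<^sup>2"
    unfolding sum_r[symmetric]
    by (intro mult_left_mono sum_mono2) (use fD r0 \<kappa> u0 in auto)
  finally have "(\<Sum>x\<in>D - D'. (r x)\<^sup>2) \<le> \<kappa> * u ^ 3 / 2"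
    by (simp add: power2_eq_square power3_eq_cube)
  moreover have "(\<Sum>x\<in>D. (r x)\<^sup>2) = (\<Sum>x\<in>D - D'. (r x)\<^sup>2) + (\<Sum>x\<in>D'. (r x)\<^sup>2)"
    by (rule sum.subset_diff) (use fD in \<open>auto simp: D'_def\<close>)
  ultimately have popular: "(\<Sum>x\<in>D'. (r x)\<^sup>2) \<ge> \<kappa> * u ^ 3 / 2"
    using sum_r2 by linarith

  \<comment> \<open>A pair \<open>(a, b)\<close> lies in \<open>B s \<times> B s\<close> for at most \<open>r (a - b)\<close> values of \<open>s\<close>, so pairs with an
    unpopular difference are rare in a typical \<open>B s\<close>.\<close>
  define bad where "bad s = {p \<in> B s \<times> B s. r (fst p - snd p) \<le> \<tau>}" for s
  define P where "P = {p \<in> U \<times> U. r (fst p - snd p) \<le> \<tau>}"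
  have fP: "finite P" using fU by (simp add: P_def)
  have fD': "finite D'" using fD by (simp add: D'_def)
  have "(\<Sum>s\<in>D'. real (card (bad s)))
      = (\<Sum>s\<in>D'. \<Sum>p\<in>P. if fst p \<in> B s \<and> snd p \<in> B s then 1 else 0)"
  proof (rule sum.cong[OF refl])
    fix s
    have "bad s = {p \<in> P. fst p \<in> B s \<and> snd p \<in> B s}"
      by (auto simp: bad_def P_def B_def)
    then show "real (card (bad s)) = (\<Sum>p\<in>P. if fst p \<in> B s \<and> snd p \<in> B s then 1 else 0)"
      using fP by (simp add: sum.If_cases Int_def)
  qed
  also have "\<dots> = (\<Sum>p\<in>P. \<Sum>s\<in>D'. if fst p \<in> B s \<and> snd p \<in> B s then 1 else 0)"
    by (rule sum.swap)
  also have "\<dots> \<le> (\<Sum>p\<in>P. \<tau>)"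
  proof (rule sum_mono)
    fix p assume p: "p \<in> P"
    have "card {s \<in> D'. fst p \<in> B s \<and> snd p \<in> B s} \<le> card (B (fst p - snd p))"
      by (rule card_inj_on_le[of "\<lambda>s. fst p - s"]) (auto simp: inj_on_def B_def fB fU algebra_simps)
    then have "real (card {s \<in> D'. fst p \<in> B s \<and> snd p \<in> B s}) \<le> r (fst p - snd p)"
      by (simp add: r_def)
    also have "\<dots> \<le> \<tau>" using p by (simp add: P_def)
    finally show "(\<Sum>s\<in>D'. if fst p \<in> B s \<and> snd p \<in> B s then 1 else 0) \<le> \<tau>"
      using fD' by (simp add: sum.If_cases Int_def)
  qed
  also have "\<dots> \<le> u\<^sup>2 * \<tau>"
  proof -
    have "card P \<le> card (U \<times> U)" by (rule card_mono) (use fU in \<open>auto simp: P_def\<close>)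
    then have "real (card P) \<le> u\<^sup>2"
      unfolding u_def power2_eq_square card_cartesian_product by (metis of_nat_le_iff of_nat_mult)
    then show ?thesis using \<tau>0 by simp
  qed
  also have "\<dots> = \<kappa> * u ^ 3 / 2 / 8"
    by (simp add: \<tau>_def power2_eq_square power3_eq_cube)
  also have "\<dots> \<le> (\<Sum>x\<in>D'. (r x)\<^sup>2 / 8)"
    using popular by (simp add: sum_divide_distrib[symmetric])
  finally have sum_bad: "(\<Sum>s\<in>D'. real (card (bad s))) \<le> (\<Sum>x\<in>D'. (r x)\<^sup>2 / 8)" .
  have "D' \<noteq> {}"
  proof
    assume "D' = {}"
    moreover have "\<kappa> * u ^ 3 > 0" using \<kappa> u0 by simp
    ultimately show False using popular by simp
  qed
  then obtain s where s: "s \<in> D'" and bad_s: "real (card (bad s)) \<le> (r s)\<^sup>2 / 8"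
    using sum_bad sum_strict_mono[OF fD'] by (metis linorder_not_le)
  define w where "w = r s"
  have w: "w \<ge> \<kappa> * u / 2" using s by (simp add: w_def D'_def)
  have w0: "w > 0" using w \<kappa> u0 by (meson less_le_trans mult_pos_pos half_gt_zero)
  define N where "N a = {b \<in> B s. r (a - b) \<le> \<tau>}" for a
  define V where "V = {a \<in> B s. real (card (N a)) \<le> w / 4}"
  have fN: "finite (N a)" for a using fB by (simp add: N_def)
  have VB: "V \<subseteq> B s" by (auto simp: V_def)
  have fV: "finite V" using VB fB finite_subset by blast
  \<comment> \<open>Markov's inequality: each discarded \<open>a\<close> accounts for more than
    \<open>w / 4\<close> of the at most \<open>w\<^sup>2 / 8\<close> bad pairs, so at most half of
    \<open>B s\<close> is lost.\<close>
  have "real (card (B s - V)) * (w / 4) = (\<Sum>a\<in>B s - V. w / 4)" by simp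
  also have "\<dots> \<le> (\<Sum>a\<in>B s - V. real (card (N a)))"
    by (rule sum_mono) (auto simp: V_def)
  also have "\<dots> \<le> (\<Sum>a\<in>B s. real (card (N a)))"
    by (rule sum_mono2) (use fB in auto)
  also have "\<dots> = real (card (SIGMA a:B s. N a))"
    by (simp add: card_SigmaI fB fN)
  also have "(SIGMA a:B s. N a) = bad s" by (auto simp: bad_def N_def)
  also have "real (card (bad s)) \<le> w\<^sup>2 / 8" using bad_s by (simp add: w_def)
  finally have "real (card (B s - V)) \<le> w / 2"
    using w0 by (simp add: power2_eq_square field_simps)
  moreover have "real (card (B s - V)) = w - real (card V)"
    using VB fV fB card_mono[OF fB VB] by (simp add: card_Diff_subset w_def r_def of_nat_diff)
  ultimately have cardV: "real (card V) \<ge> w / 2" by linarith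

  \<comment> \<open>Each \<open>a - a' = (a - b) - (a' - b)\<close> with \<open>a, a' \<in> V\<close> has many representations with both
    differences on the right popular.\<close>
  define Q where "Q x = {(p, q, v, z). p \<in> U \<and> q \<in> U \<and> v \<in> U \<and> z \<in> U \<and> (p - q) - (v - z) = x}" for x
  have QU: "Q x \<subseteq> U \<times> U \<times> U \<times> U" for x by (auto simp: Q_def)
  have fU4: "finite (U \<times> U \<times> U \<times> U)" using fU by simp
  have fQ: "finite (Q x)" for x using QU fU4 by (rule finite_subset)
  have many: "w / 2 * \<tau>\<^sup>2 \<le> real (card (Q (a - a')))" if a: "a \<in> V" "a' \<in> V" for a a'
  proof -
    define G where "G = B s - N a - N a'"
    have fG: "finite G" using fB by (simp add: G_def)
    have "card (B s) \<le> card (G \<union> N a \<union> N a')"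
      by (rule card_mono) (use fG fN in \<open>auto simp: G_def\<close>)
    also have "\<dots> \<le> card (G \<union> N a) + card (N a')" by (rule card_Un_le)
    also have "\<dots> \<le> card G + card (N a) + card (N a')" using card_Un_le[of G "N a"] by simp
    finally have "w \<le> real (card G) + real (card (N a)) + real (card (N a'))"
      unfolding w_def r_def by (metis of_nat_le_iff of_nat_add)
    then have cG: "real (card G) \<ge> w / 2" using a by (auto simp: V_def)
    have "w / 2 * \<tau>\<^sup>2 \<le> real (card G) * \<tau>\<^sup>2" using cG by (intro mult_right_mono) auto
    also have "\<dots> = (\<Sum>b\<in>G. \<tau> * \<tau>)" by (simp add: power2_eq_square)
    also have "\<dots> \<le> (\<Sum>b\<in>G. r (a - b) * r (a' - b))"
      by (rule sum_mono, rule mult_mono) (use \<tau>0 r0 in \<open>auto simp: G_def N_def\<close>)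
    also have "\<dots> = real (card (SIGMA b:G. B (a - b) \<times> B (a' - b)))"
      by (simp add: card_SigmaI fG fB r_def card_cartesian_product)
    also have "\<dots> \<le> real (card (Q (a - a')))"
    proof (rule of_nat_mono, rule card_inj_on_le[of "\<lambda>(b, p, v). (p, p - (a - b), v, v - (a' - b))"])
      show "inj_on (\<lambda>(b, p, v). (p, p - (a - b), v, v - (a' - b))) (SIGMA b:G. B (a - b) \<times> B (a' - b))"
        by (auto simp: inj_on_def)
      show "(\<lambda>(b, p, v). (p, p - (a - b), v, v - (a' - b))) ` (SIGMA b:G. B (a - b) \<times> B (a' - b)) \<subseteq> Q (a - a')"
        by (auto simp: Q_def B_def)
    qed (rule fQ)
    finally show ?thesis .
  qed
  \<comment> \<open>Double counting: the sets \<open>Q x\<close> for different \<open>x\<close> are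
    disjoint inside the fourfold product of \<open>U\<close>.\<close>
  have "real (card (V + uminus ` V)) * (w / 2 * \<tau>\<^sup>2) = (\<Sum>x\<in>V + uminus ` V. w / 2 * \<tau>\<^sup>2)" by simp
  also have "\<dots> \<le> (\<Sum>x\<in>V + uminus ` V. real (card (Q x)))"
  proof (rule sum_mono)
    fix x assume "x \<in> V + uminus ` V"
    then obtain a a' where "a \<in> V" "a' \<in> V" "x = a - a'" by (auto elim!: set_plus_elim)
    then show "w / 2 * \<tau>\<^sup>2 \<le> real (card (Q x))" using many by blast
  qed
  also have "\<dots> = real (card (\<Union>x\<in>V + uminus ` V. Q x))"
    by (subst card_UN_disjoint) (use fV fQ in \<open>auto simp: finite_set_plus Q_def\<close>)
  also have "\<dots> \<le> real (card (U \<times> U \<times> U \<times> U))"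
    by (intro of_nat_mono card_mono fU4) (use QU in blast)
  also have "\<dots> = u ^ 4" by (simp add: u_def card_cartesian_product power4_eq_xxxx)
  finally have upper: "real (card (V + uminus ` V)) * (w / 2 * \<tau>\<^sup>2) \<le> u ^ 4" .
  have "real (card (V + uminus ` V)) * (\<kappa> * u / 2 / 2 * \<tau>\<^sup>2) \<le> real (card (V + uminus ` V)) * (w / 2 * \<tau>\<^sup>2)"
    using w by (intro mult_left_mono mult_right_mono) auto
  then have "real (card (V + uminus ` V)) * (\<kappa> * u / 2 / 2 * \<tau>\<^sup>2) \<le> u ^ 4" using upper by linarith
  \<comment> \<open>The constant 1024 is 4 times the square of the 16 in
    \<open>\<tau>\<close>.\<close>
  moreover have "\<kappa> * u / 2 / 2 * \<tau>\<^sup>2 = \<kappa> ^ 3 * u ^ 3 / 1024"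
    by (simp add: \<tau>_def power2_eq_square power3_eq_cube)
  ultimately have "real (card (V + uminus ` V)) * (\<kappa> ^ 3 * u ^ 3 / 1024) \<le> u ^ 4" by (simp only:)
  then have "real (card (V + uminus ` V)) * \<kappa> ^ 3 * u ^ 3 \<le> 1024 * u * u ^ 3"
    by (simp add: field_simps power4_eq_xxxx power3_eq_cube)
  then have "real (card (V + uminus ` V)) * \<kappa> ^ 3 \<le> 1024 * u" using u0 by simp
  then have "real (card (V + uminus ` V)) \<le> 1024 / \<kappa> ^ 3 * u" using \<kappa> by (simp add: field_simps)
  moreover have "V \<subseteq> U" using VB by (auto simp: B_def)
  moreover have "real (card V) \<ge> \<kappa> * u / 4" using cardV w by linarith
  ultimately show ?thesis using that by (simp add: u_def)
qed

section \<open>From failure of L^2 flattening to a set of small doubling\<close>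

lemma sum_shift_le:
  fixes \<phi> :: "'a::ab_group_add \<Rightarrow> real"
  assumes "finite S" "finite B" "\<And>x. \<phi> x \<ge> 0" "\<And>x. x \<notin> S \<Longrightarrow> \<phi> x = 0"
  shows "(\<Sum>b\<in>B. \<phi> (b - x)) \<le> sum \<phi> S"
proof -
  have "(\<Sum>b\<in>B. \<phi> (b - x)) = sum \<phi> ((\<lambda>b. b - x) ` B)"
    by (simp add: sum.reindex inj_on_def)
  also have "\<dots> = sum \<phi> ((\<lambda>b. b - x) ` B \<inter> S)"
    by (rule sum.mono_neutral_right) (use assms in auto)
  also have "\<dots> \<le> sum \<phi> S"
    by (rule sum_mono2) (use assms in auto)
  finally show ?thesis .
qed

text \<open>Weighted AM-GM in place of Cauchy--Schwarz, which avoids square roots. Shifting cannot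
  increase the sum of squares of \<open>f\<close> because \<open>f\<close> vanishes off
  \<open>S\<close>. The parameter \<open>l\<close> serves to balance the two terms when
  \<open>g\<close> has much smaller norm than \<open>f\<close>.\<close>

lemma sum_mult_shift_le:
  fixes f g :: "'a::ab_group_add \<Rightarrow> real"
  assumes "finite S" "\<And>x. x \<notin> S \<Longrightarrow> f x = 0" and l: "l > 0"
  shows "(\<Sum>b\<in>S. g b * f (b - x)) \<le> l / 2 * (\<Sum>b\<in>S. (g b)\<^sup>2) + (\<Sum>b\<in>S. (f b)\<^sup>2) / (2 * l)"
proof -
  have amgm: "u * v \<le> l / 2 * u\<^sup>2 + v\<^sup>2 / (2 * l)" for u v :: real
  proof -
    have "0 \<le> (l * u - v)\<^sup>2 / (2 * l)" using l by simp
    also have "\<dots> = l / 2 * u\<^sup>2 + v\<^sup>2 / (2 * l) - u * v"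
      using l by (simp add: field_simps power2_eq_square)
    finally show ?thesis by linarith
  qed
  have "(\<Sum>b\<in>S. g b * f (b - x)) \<le> (\<Sum>b\<in>S. l / 2 * (g b)\<^sup>2 + (f (b - x))\<^sup>2 / (2 * l))"
    by (rule sum_mono) (rule amgm)
  also have "\<dots> = l / 2 * (\<Sum>b\<in>S. (g b)\<^sup>2) + (\<Sum>b\<in>S. (f (b - x))\<^sup>2) / (2 * l)"
    by (simp add: sum.distrib sum_distrib_left sum_divide_distrib)
  also have "\<dots> \<le> l / 2 * (\<Sum>b\<in>S. (g b)\<^sup>2) + (\<Sum>b\<in>S. (f b)\<^sup>2) / (2 * l)"
    using l sum_shift_le[of S S "\<lambda>b. (f b)\<^sup>2" x] assms by (intro add_left_mono divide_right_mono) auto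
  finally show ?thesis .
qed

text \<open>The sum in \<open>T\<close> runs over additive quadruples weighted by \<open>f\<close>.
  Those leaving the level set \<open>U\<close> account for at most half of the lower bound
  \<open>Q / L\<close>, and each of the remaining ones weighs at most
  \<open>(M * Q) ^ 4\<close>.\<close>

lemma level_set_energy:
  fixes f :: "'a::ab_group_add \<Rightarrow> real" and L M Q :: real
  assumes fS: "finite S" and nonneg: "\<And>x. f x \<ge> 0" and supp: "\<And>x. x \<notin> S \<Longrightarrow> f x = 0"
    and mass: "sum f S = 1" and Q: "Q = (\<Sum>x\<in>S. (f x)\<^sup>2)" and L: "L \<ge> 1" and M: "M = 256 * L\<^sup>2"
    and T: "(\<Sum>a\<in>S. \<Sum>c\<in>S. \<Sum>b\<in>S. f a * f c * f b * f (b - (a - c))) \<ge> Q / L"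
    and U: "U = {x \<in> S. Q / M \<le> f x \<and> f x \<le> M * Q}"
  shows "(\<Sum>a\<in>U. \<Sum>c\<in>U. real (card {b \<in> U. b - (a - c) \<in> U})) * (M * Q) ^ 4 \<ge> Q / (2 * L)"
proof -
  have M0: "M > 0" using L M by simp
  have Q0: "Q \<ge> 0" using Q by (simp add: sum_nonneg)
  define R where "R = {(a, c, b, d). a \<in> S \<and> c \<in> S \<and> b \<in> S \<and> d \<in> S \<and> a - c = b - d}"
  have solve: "a - c = b - d \<longleftrightarrow> d = b - (a - c)" for a b c d :: 'a
    by (auto simp: algebra_simps)
  have RS: "R \<subseteq> S \<times> S \<times> S \<times> S" by (auto simp: R_def)
  have fR: "finite R" by (rule finite_subset[OF RS]) (use fS in simp)
  define t where "t e1 e2 e3 e4 = (\<Sum>(a, c, b, d)\<in>R. e1 a * e2 c * e3 b * e4 d)" for e1 e2 e3 e4 :: "'a \<Rightarrow> real"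
  \<comment> \<open>The fourth entry is determined by the other three. Terms in which it falls
    outside \<open>S\<close> vanish because the last factor is \<open>f\<close>.\<close>
  have expand: "t e1 e2 e3 f = (\<Sum>a\<in>S. \<Sum>c\<in>S. \<Sum>b\<in>S. e1 a * e2 c * e3 b * f (b - (a - c)))" for e1 e2 e3
  proof -
    have "(\<Sum>a\<in>S. \<Sum>c\<in>S. \<Sum>b\<in>S. e1 a * e2 c * e3 b * f (b - (a - c)))
        = (\<Sum>(a, c, b)\<in>S \<times> S \<times> S. e1 a * e2 c * e3 b * f (b - (a - c)))"
      by (simp add: sum.cartesian_product)
    also have "\<dots> = (\<Sum>(a, c, b)\<in>{(a, c, b). a \<in> S \<and> c \<in> S \<and> b \<in> S \<and> b - (a - c) \<in> S}.
        e1 a * e2 c * e3 b * f (b - (a - c)))"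
      by (rule sum.mono_neutral_right) (use fS in \<open>auto intro: supp\<close>)
    also have "\<dots> = t e1 e2 e3 f"
      unfolding t_def R_def
      by (rule sum.reindex_bij_witness[of _ "\<lambda>(a, c, b, d). (a, c, b)" "\<lambda>(a, c, b). (a, c, b, b - (a - c))"])
        (auto simp: solve)
    finally show ?thesis by simp
  qed
  \<comment> \<open>The symmetries of \<open>a - c = b - d\<close> carry each slot to the first, so
    an exceptional factor has to be estimated in one convenient slot only.\<close>
  have sym2: "t f e f f = t e f f f" for e
    unfolding t_def R_def
    by (rule sum.reindex_bij_witness[of _ "\<lambda>(a, c, b, d). (c, a, d, b)" "\<lambda>(a, c, b, d). (c, a, d, b)"])
      (auto simp: algebra_simps)
  have sym3: "t f f e f = t e f f f" for e
    unfolding t_def R_def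
    by (rule sum.reindex_bij_witness[of _ "\<lambda>(a, c, b, d). (b, d, a, c)" "\<lambda>(a, c, b, d). (b, d, a, c)"])
      (auto simp: algebra_simps)
  have sym4: "t f f f e = t e f f f" for e
    unfolding t_def R_def
    by (rule sum.reindex_bij_witness[of _ "\<lambda>(a, c, b, d). (d, b, c, a)" "\<lambda>(a, c, b, d). (d, b, c, a)"])
      (auto simp: algebra_simps)

  \<comment> \<open>High values of \<open>f\<close> carry little mass and low values little \<open>L\<^sup>2\<close> norm, so quadruples meeting
    either contribute at most half of the energy.\<close>
  define h where "h x = (if f x > M * Q then f x else 0)" for x
  define l where "l x = (if f x < Q / M then f x else 0)" for x
  define m where "m x = (if x \<in> U then f x else 0)" for x
  have h0: "h x \<ge> 0" and l0: "l x \<ge> 0" and m0: "m x \<ge> 0" for x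
    using nonneg by (auto simp: h_def l_def m_def)
  have dec: "f x \<le> m x + (h x + l x)" if "x \<in> S" for x
    using that nonneg[of x] by (auto simp: h_def l_def m_def U)
  have mf: "m x \<le> f x" for x using nonneg by (auto simp: m_def)

  \<comment> \<open>Where \<open>h\<close> is nonzero, \<open>f\<close> exceeds
    \<open>M * Q\<close>, so the mass of \<open>h\<close> is at most 1/M. The bound is kept
    multiplied by \<open>Q\<close>, so that no division by \<open>Q\<close> occurs.\<close>
  have "M * Q * sum h S = (\<Sum>x\<in>S. M * Q * h x)" by (simp add: sum_distrib_left)
  also have "\<dots> \<le> (\<Sum>x\<in>S. (f x)\<^sup>2)"
    by (rule sum_mono) (auto simp: h_def power2_eq_square intro!: mult_right_mono nonneg)
  finally have "Q * (M * sum h S) \<le> Q" by (simp add: Q mult_ac)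
  then have hQ: "sum h S * Q \<le> Q / M" using M0 by (simp add: field_simps)
  have "t h f f f = (\<Sum>a\<in>S. \<Sum>c\<in>S. h a * f c * (\<Sum>b\<in>S. f b * f (b - (a - c))))"
    by (simp add: expand sum_distrib_left mult.assoc)
  also have "\<dots> \<le> (\<Sum>a\<in>S. \<Sum>c\<in>S. h a * f c * Q)"
    using sum_mult_shift_le[of S f 1 f] h0 nonneg fS supp
    by (intro sum_mono mult_left_mono) (auto simp: Q)
  also have "\<dots> = sum h S * Q"
    by (simp add: sum_distrib_left[symmetric] sum_distrib_right[symmetric] mass)
  finally have th: "t h f f f \<le> Q / M" using hQ by linarith

  have "(\<Sum>x\<in>S. (l x)\<^sup>2) \<le> (\<Sum>x\<in>S. Q / M * f x)"
  proof (rule sum_mono)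
    fix x
    have "l x * l x \<le> Q / M * f x"
      using Q0 M0 nonneg[of x] by (intro mult_mono) (auto simp: l_def)
    then show "(l x)\<^sup>2 \<le> Q / M * f x" by (simp add: power2_eq_square)
  qed
  also have "\<dots> = Q / M" unfolding sum_distrib_left[symmetric] mass by simp
  finally have l2: "(\<Sum>x\<in>S. (l x)\<^sup>2) \<le> Q / M" .
  have inner: "(\<Sum>b\<in>S. l b * f (b - x)) \<le> Q / (16 * L)" for x
  proof -
    \<comment> \<open>The weight \<open>16 * L\<close> balances the terms: with
      \<open>M = 256 * L\<^sup>2\<close> each of them equals Q/(32 L).\<close>
    have "(\<Sum>b\<in>S. l b * f (b - x)) \<le> (16 * L) / 2 * (\<Sum>b\<in>S. (l b)\<^sup>2) + Q / (2 * (16 * L))"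
      unfolding Q by (rule sum_mult_shift_le) (use fS supp L in auto)
    also have "\<dots> \<le> (16 * L) / 2 * (Q / M) + Q / (2 * (16 * L))"
      using l2 L by (intro add_right_mono mult_left_mono) auto
    also have "\<dots> = Q / (16 * L)" using L by (simp add: M field_simps power2_eq_square)
    finally show ?thesis .
  qed
  have "t f f l f = (\<Sum>a\<in>S. \<Sum>c\<in>S. f a * f c * (\<Sum>b\<in>S. l b * f (b - (a - c))))"
    by (simp add: expand sum_distrib_left mult.assoc)
  also have "\<dots> \<le> (\<Sum>a\<in>S. \<Sum>c\<in>S. f a * f c * (Q / (16 * L)))"
    using nonneg by (intro sum_mono mult_left_mono inner) auto
  also have "\<dots> = Q / (16 * L)"
    unfolding sum_distrib_left[symmetric] sum_distrib_right[symmetric] mass by simp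
  finally have tl: "t l f f f \<le> Q / (16 * L)" by (simp add: sym3)

  define e where "e x = h x + l x" for x
  have e0: "e x \<ge> 0" for x using h0 l0 by (simp add: e_def)
  have te: "t e f f f = t h f f f + t l f f f"
    by (simp add: t_def e_def sum.distrib[symmetric] case_prod_unfold algebra_simps)
  \<comment> \<open>Telescoping: \<open>f\<close> is replaced by \<open>m + e\<close> one slot at a
    time, and in each error term the factors \<open>m\<close> already produced are bounded by
    \<open>f\<close> again.\<close>
  have "t f f f f \<le> t m m m m + (t e f f f + t f e f f + t f f e f + t f f f e)"
  proof -
    have "f a * f c * f b * f d \<le> m a * m c * m b * m d + (e a * f c * f b * f d + f a * e c * f b * f d
        + f a * f c * e b * f d + f a * f c * f b * e d)"
      if "a \<in> S" "c \<in> S" "b \<in> S" "d \<in> S" for a c b d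
    proof -
      have D: "f x \<le> m x + e x" if "x \<in> S" for x using dec[OF that] by (simp add: e_def)
      note nn = nonneg m0 e0 mf
      have "f a * (f c * f b * f d) \<le> (m a + e a) * (f c * f b * f d)"
        by (rule mult_right_mono[OF D[OF that(1)]]) (simp add: nn)
      moreover have "f c * (m a * f b * f d) \<le> (m c + e c) * (m a * f b * f d)"
        by (rule mult_right_mono[OF D[OF that(2)]]) (simp add: nn)
      moreover have "f b * (m a * m c * f d) \<le> (m b + e b) * (m a * m c * f d)"
        by (rule mult_right_mono[OF D[OF that(3)]]) (simp add: nn)
      moreover have "f d * (m a * m c * m b) \<le> (m d + e d) * (m a * m c * m b)"
        by (rule mult_right_mono[OF D[OF that(4)]]) (simp add: nn)
      moreover have "m a * (e c * f b * f d) \<le> f a * (e c * f b * f d)"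
        by (rule mult_right_mono) (simp_all add: nn)
      moreover have "(m a * m c) * (e b * f d) \<le> (f a * f c) * (e b * f d)"
        by (intro mult_right_mono mult_mono) (simp_all add: nn)
      moreover have "(m a * m c * m b) * e d \<le> (f a * f c * f b) * e d"
        by (intro mult_right_mono mult_mono) (simp_all add: nn)
      ultimately show ?thesis by (simp add: algebra_simps)
    qed
    then show ?thesis
      unfolding t_def sum.distrib[symmetric] case_prod_unfold
      by (intro sum_mono) (auto simp: R_def)
  qed
  also have "\<dots> = t m m m m + 4 * (t h f f f + t l f f f)" by (simp add: sym2 sym3 sym4 te)
  \<comment> \<open>Both errors are at most Q/(16 L), so the four slots together lose at most 8
    Q/(16 L), half of the energy bound.\<close>
  also have "\<dots> \<le> t m m m m + 4 * (Q / M + Q / (16 * L))" using th tl by simp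
  also have "\<dots> \<le> t m m m m + Q / (2 * L)"
  proof -
    have "Q / M \<le> Q / (16 * L)"
    proof (rule divide_left_mono)
      have "L * 1 \<le> L * L" using L by (intro mult_left_mono) auto
      then show "16 * L \<le> M" using L by (simp add: M power2_eq_square)
    qed (use Q0 M0 L in auto)
    then show ?thesis by simp
  qed
  finally have "Q / L \<le> t m m m m + Q / (2 * L)" using T expand[of f f f] by simp
  moreover have "Q / L = 2 * (Q / (2 * L))" by simp
  ultimately have tm: "Q / (2 * L) \<le> t m m m m" by linarith

  define R' where "R' = {(a, c, b, d). a \<in> U \<and> c \<in> U \<and> b \<in> U \<and> d \<in> U \<and> a - c = b - d}"
  have US: "U \<subseteq> S" by (auto simp: U)
  have fU: "finite U" using US fS finite_subset by blast
  have "t m m m m = (\<Sum>(a, c, b, d)\<in>R'. m a * m c * m b * m d)"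
    unfolding t_def by (rule sum.mono_neutral_right[OF fR]) (use US in \<open>auto simp: R_def R'_def m_def split: if_splits\<close>)
  also have "\<dots> \<le> (\<Sum>p\<in>R'. (M * Q) ^ 4)"
  proof (rule sum_mono, clarify)
    fix a c b d assume "(a, c, b, d) \<in> R'"
    then have *: "m a \<le> M * Q" "m c \<le> M * Q" "m b \<le> M * Q" "m d \<le> M * Q"
      by (auto simp: R'_def m_def U)
    have "m a * m c * m b * m d \<le> (M * Q) * (M * Q) * (M * Q) * (M * Q)"
      using * m0 M0 Q0 by (intro mult_mono) auto
    then show "m a * m c * m b * m d \<le> (M * Q) ^ 4" by (simp add: power4_eq_xxxx)
  qed
  also have "\<dots> = real (card R') * (M * Q) ^ 4" by simp
  also have "card R' = card (SIGMA a:U. SIGMA c:U. {b \<in> U. b - (a - c) \<in> U})"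
    by (rule bij_betw_same_card[of "\<lambda>(a, c, b, d). (a, c, b)"],
        rule bij_betwI[where g = "\<lambda>(a, c, b). (a, c, b, b - (a - c))"])
      (auto simp: R'_def solve)
  also have "real \<dots> = (\<Sum>a\<in>U. \<Sum>c\<in>U. real (card {b \<in> U. b - (a - c) \<in> U}))"
    using fU by (simp add: card_SigmaI)
  finally show ?thesis using tm by linarith
qed

text \<open>By \<open>level_set_energy\<close> the level set \<open>U\<close> has energy within a
  power of \<open>L\<close> of the maximum, and its size is 1/Q up to such powers.
  Balog--Szemeredi--Gowers applies to \<open>U\<close>, and since \<open>f\<close> is at least
  \<open>Q / M\<close> on it, any subset of size about 1/Q has substantial mass.\<close>

lemma small_doubling_of_flattening_failure:
  fixes f :: "'a::ab_group_add \<Rightarrow> real" and L Q :: real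
  assumes fS: "finite S" and nonneg: "\<And>x. f x \<ge> 0" and supp: "\<And>x. x \<notin> S \<Longrightarrow> f x = 0"
    and mass: "sum f S = 1" and Q: "Q = (\<Sum>x\<in>S. (f x)\<^sup>2)" and L: "L \<ge> 1"
    and T: "(\<Sum>a\<in>S. \<Sum>c\<in>S. \<Sum>b\<in>S. f a * f c * f b * f (b - (a - c))) \<ge> Q / L"
  obtains V where "V \<subseteq> S" "V \<noteq> {}" "real (card V) \<le> 1 / Q"
    "sum f V \<ge> 1 / (2 ^ 281 * L ^ 71)"
    "real (card (V + uminus ` V)) \<le> 2 ^ 281 * L ^ 71 * real (card V)"
proof -
  define M where "M = 256 * L\<^sup>2"
  define U where "U = {x \<in> S. Q / M \<le> f x \<and> f x \<le> M * Q}"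
  define u where "u = real (card U)"
  define N where "N = 1 / Q"
  have L2: "L\<^sup>2 \<ge> 1" using L by simp
  have M1: "M \<ge> 256" using L2 by (simp add: M_def)
  have M0: "M > 0" using M1 by linarith
  have Q0: "Q > 0"
  proof -
    obtain x where "x \<in> S" "f x \<noteq> 0" using mass by (metis sum.neutral zero_neq_one)
    then have "(\<Sum>x\<in>S. (f x)\<^sup>2) > 0" using fS by (intro sum_pos2[of S x]) auto
    then show ?thesis by (simp add: Q)
  qed
  have Q1: "Q \<le> 1"
  proof -
    have "f x \<le> 1" if "x \<in> S" for x
      using member_le_sum[OF that, of f] nonneg fS by (simp add: mass)
    then have "Q \<le> sum f S"
      unfolding Q power2_eq_square using nonneg by (intro sum_mono mult_left_le) auto
    then show ?thesis by (simp add: mass)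
  qed
  have N1: "N \<ge> 1" using Q0 Q1 by (simp add: N_def)
  have US: "U \<subseteq> S" by (auto simp: U_def)
  have fU: "finite U" using US fS finite_subset by blast
  define E where "E = (\<Sum>a\<in>U. \<Sum>c\<in>U. real (card {b \<in> U. b - (a - c) \<in> U}))"
  have "E * (M * Q) ^ 4 \<ge> Q / (2 * L)"
    unfolding E_def by (rule level_set_energy[OF fS nonneg supp mass Q L M_def T U_def])
  then have EN: "E \<ge> N ^ 3 / (2 * L * M ^ 4)"
    using Q0 M0 L by (simp add: N_def field_simps power4_eq_xxxx power3_eq_cube)
  have "E \<le> (\<Sum>a\<in>U. \<Sum>c\<in>U. u)"
    unfolding E_def u_def by (intro sum_mono of_nat_mono card_mono fU) auto
  then have Eu: "E \<le> u ^ 3" by (simp add: u_def power3_eq_cube)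
  have "u * (Q / M) = (\<Sum>x\<in>U. Q / M)" by (simp add: u_def)
  also have "\<dots> \<le> sum f U" by (rule sum_mono) (auto simp: U_def)
  also have "\<dots> \<le> sum f S" by (rule sum_mono2) (use fS US nonneg in auto)
  finally have uN: "u \<le> M * N" using Q0 M0 by (simp add: mass N_def field_simps)
  have u0: "u \<ge> 0" by (simp add: u_def)

  \<comment> \<open>This is the ratio of the energy bound \<open>N ^ 3 / (2 * L * M ^ 4)\<close> to
    \<open>(M * N) ^ 3\<close>, the largest possible value of \<open>u ^ 3\<close>.\<close>
  define \<kappa> where "\<kappa> = 1 / (2 * L * M ^ 7)"
  have \<kappa>0: "\<kappa> > 0" using L M0 by (simp add: \<kappa>_def)
  have "\<kappa> * u ^ 3 \<le> \<kappa> * (M * N) ^ 3"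
    using uN u0 \<kappa>0 by (intro mult_left_mono power_mono) auto
  also have "\<dots> = N ^ 3 / (2 * L * M ^ 4)"
  proof -
    have M7: "M ^ 7 = M ^ 3 * M ^ 4" by (simp flip: power_add)
    have "1 / (2 * L * (x * y)) * (x * z) = z / (2 * L * y)" if "x \<noteq> 0" for x y z :: real
      using that by simp
    from this[of "M ^ 3" "M ^ 4" "N ^ 3"] show ?thesis
      unfolding \<kappa>_def power_mult_distrib M7 using M0 by (metis less_irrefl power_not_zero)
  qed
  finally have \<kappa>E: "\<kappa> * real (card U) ^ 3 \<le> E" using EN by (simp add: u_def)
  \<comment> \<open>The trivial bound E \<le> u^3 gives u^3 \<ge> N^3 / G. The cube root of
    \<open>G\<close> is weakened to \<open>G\<close> itself, which is harmless as
    \<open>G \<ge> 1\<close>.\<close>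
  define G where "G = 2 * L * M ^ 4"
  have G1: "G \<ge> 1"
  proof -
    have "1 * 1 \<le> (2 * L) * M ^ 4" using L M1 by (intro mult_mono one_le_power) auto
    then show ?thesis by (simp add: G_def)
  qed
  have "(N / G) ^ 3 \<le> N ^ 3 / G"
  proof -
    have "G ^ 1 \<le> G ^ 3" using G1 by (intro power_increasing) auto
    then show ?thesis unfolding power_divide using G1 N1 by (intro divide_left_mono) auto
  qed
  also have "\<dots> \<le> u ^ 3" using EN Eu by (simp add: G_def)
  finally have "(N / G) ^ 3 \<le> u ^ 3" .
  then have uG: "N / G \<le> u" using power_strict_mono[of u "N / G" 3] u0 by linarith
  have NG0: "N / G > 0" using N1 G1 by simp
  have Une: "U \<noteq> {}" using uG NG0 by (auto simp: u_def)
  obtain V0 where V0: "V0 \<subseteq> U" "real (card V0) \<ge> \<kappa> * real (card U) / 4"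
    "real (card (V0 + uminus ` V0)) \<le> 1024 / \<kappa> ^ 3 * real (card U)"
    using balog_szemeredi_gowers_diff[OF fU Une \<kappa>0] \<kappa>E unfolding E_def by blast
  have fV0: "finite V0" using V0 fU finite_subset by blast

  \<comment> \<open>This is \<open>4 * G / \<kappa>\<close>, so \<open>N / P\<close> is the lower
    bound for the size of \<open>V0\<close>.\<close>
  define P where "P = 16 * L\<^sup>2 * M ^ 11"
  have P2: "P \<ge> 2"
  proof -
    have "(2 * 1) * 1 \<le> (16 * L\<^sup>2) * M ^ 11" using L L2 M1 by (intro mult_mono one_le_power) auto
    then show ?thesis by (simp add: P_def)
  qed
  have "N / P = \<kappa> * (N / G) / 4"
  proof -
    have "M ^ 11 = M ^ 7 * M ^ 4" by (simp flip: power_add)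
    then show ?thesis by (simp add: P_def \<kappa>_def G_def power2_eq_square mult_ac)
  qed
  also have "\<dots> \<le> \<kappa> * u / 4" using uG \<kappa>0 by (intro divide_right_mono mult_left_mono) auto
  finally have V0P: "N / P \<le> real (card V0)" using V0(2) unfolding u_def by (rule order_trans)
  \<comment> \<open>\<open>V0\<close> may have more than 1/Q elements, so it is cut down to a subset
    of at most \<open>N\<close>. Rounding costs at most a factor 2, absorbed by
    \<open>P \<ge> 2\<close>, and the difference set can only shrink.\<close>
  define p where "p = min (card V0) (nat \<lfloor>N\<rfloor>)"
  have fl: "real (nat \<lfloor>N\<rfloor>) \<le> N" "N / 2 \<le> real (nat \<lfloor>N\<rfloor>)"
  proof -
    have "\<lfloor>N\<rfloor> \<ge> 1" using N1 by simp
    then have "real (nat \<lfloor>N\<rfloor>) = of_int \<lfloor>N\<rfloor>" "real (nat \<lfloor>N\<rfloor>) \<ge> 1" by linarith+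
    then show "real (nat \<lfloor>N\<rfloor>) \<le> N" "N / 2 \<le> real (nat \<lfloor>N\<rfloor>)" by linarith+
  qed
  have pN: "real p \<le> N" using fl by (simp add: p_def min_def)
  have "N / P \<le> N / 2" using P2 N1 by (intro divide_left_mono) auto
  then have "N / P \<le> real (nat \<lfloor>N\<rfloor>)" using fl by linarith
  then have pP: "N / P \<le> real p" using V0P by (metis p_def min_def)
  obtain V where V: "V \<subseteq> V0" "card V = p" "finite V"
    using obtain_subset_with_card_n[of p V0] by (auto simp: p_def)
  have NP0: "N / P > 0" using N1 P2 by simp
  \<comment> \<open>The loss in the doubling, \<open>1024 / \<kappa> ^ 3 * M * P\<close>, which also
    dominates the loss \<open>P * M\<close> in the mass. Substituting
    \<open>M = 256 * L\<^sup>2\<close> yields the exponents 17 + 8 * 33 = 281 and 5 + 2 * 33 =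
    71.\<close>
  define H where "H = 131072 * L ^ 5 * M ^ 33"
  have H: "H = 2 ^ 281 * L ^ 71"
    by (simp add: H_def M_def power_mult_distrib flip: power_mult power_add)
  show ?thesis
  proof (rule that[of V])
    show "V \<subseteq> S" using V V0 US by blast
    show "V \<noteq> {}" using pP NP0 V by auto
    show "real (card V) \<le> 1 / Q" using pN V by (simp add: N_def)
    have "P * M \<le> H"
    proof -
      have "16 * L\<^sup>2 * M ^ 12 \<le> 131072 * L ^ 5 * M ^ 33"
        using L M1 by (intro mult_mono power_increasing) auto
      moreover have "M ^ 12 = M ^ 11 * M" by (simp flip: power_Suc2)
      ultimately show ?thesis by (simp add: P_def H_def mult.assoc)
    qed
    then have "1 / H \<le> 1 / (P * M)" using P2 M0 by (intro frac_le) auto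
    also have "\<dots> = N / P * (Q / M)" using Q0 by (simp add: N_def)
    also have "\<dots> \<le> real p * (Q / M)" using pP Q0 M0 by (intro mult_right_mono) auto
    also have "\<dots> = (\<Sum>x\<in>V. Q / M)" by (simp add: V)
    also have "\<dots> \<le> sum f V" by (rule sum_mono) (use V V0 in \<open>auto simp: U_def\<close>)
    finally show "sum f V \<ge> 1 / (2 ^ 281 * L ^ 71)" by (simp add: H)
    have "real (card (V + uminus ` V)) \<le> real (card (V0 + uminus ` V0))"
      by (intro of_nat_mono card_mono finite_set_plus set_plus_mono2) (use fV0 V in auto)
    also have "\<dots> \<le> 1024 / \<kappa> ^ 3 * u" using V0 by (simp add: u_def)
    also have "\<dots> \<le> 1024 / \<kappa> ^ 3 * (M * N)" using uN \<kappa>0 by (intro mult_left_mono) auto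
    also have "\<dots> = 1024 / \<kappa> ^ 3 * M * P * (N / P)" using P2 by simp
    also have "\<dots> \<le> 1024 / \<kappa> ^ 3 * M * P * real p"
      using pP \<kappa>0 M0 P2 by (intro mult_left_mono) auto
    also have "1024 / \<kappa> ^ 3 * M * P = H"
    proof -
      have "1024 / \<kappa> ^ 3 = 8192 * (L ^ 3 * M ^ 21)"
        by (simp add: \<kappa>_def power_divide power_mult_distrib flip: power_mult)
      moreover have "(L ^ 3 * M ^ 21) * M * (L\<^sup>2 * M ^ 11) = L ^ (3 + 2) * M ^ (21 + 1 + 11)"
        by (simp only: power_add power_one_right ac_simps)
      ultimately show ?thesis by (simp add: P_def H_def)
    qed
    finally show "real (card (V + uminus ` V)) \<le> 2 ^ 281 * L ^ 71 * real (card V)"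
      by (simp add: H V)
  qed
qed

section \<open>Convolution powers\<close>

lemma sumset_add_mem: "x \<in> sumset j A \<Longrightarrow> y \<in> sumset k A \<Longrightarrow> x + y \<in> sumset (j + k) A"
proof (induction k arbitrary: y)
  case (Suc k)
  then obtain v a where y: "y = v + a" "v \<in> sumset k A" "a \<in> A"
    by (auto simp: sumset_Suc elim!: set_plus_elim)
  then have "x + v + a \<in> sumset (Suc (j + k)) A"
    unfolding sumset_Suc using Suc by (intro set_plus_intro) auto
  then show ?case using y by (simp add: add.assoc)
qed simp

text \<open>\<open>rep k A\<close> is the \<open>k\<close>-fold convolution of the indicator function of \<open>A\<close>.\<close>

primrec rep :: "nat \<Rightarrow> real set \<Rightarrow> real \<Rightarrow> real" where
  "rep 0 A x = of_bool (x = 0)"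
| "rep (Suc k) A x = (\<Sum>a\<in>A. rep k A (x - a))"

text \<open>This is the energy of order \<open>k\<close>, as \<open>energy_eq_l2mass\<close> shows,
  in a form suited to convolution estimates.\<close>

definition l2mass :: "nat \<Rightarrow> real set \<Rightarrow> real" where
  "l2mass k A = (\<Sum>x\<in>sumset k A. (rep k A x)\<^sup>2)"

lemma rep_nonneg: "rep k A x \<ge> 0"
  by (induction k arbitrary: x) (auto intro: sum_nonneg)

lemma rep_eq_0: "x \<notin> sumset k A \<Longrightarrow> rep k A x = 0"
proof (induction k arbitrary: x)
  case (Suc k)
  have "x - a \<notin> sumset k A" if "a \<in> A" for a
  proof
    assume "x - a \<in> sumset k A"
    then have "(x - a) + a \<in> sumset (Suc k) A" using that unfolding sumset_Suc by (rule set_plus_intro)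
    then show False using Suc.prems by simp
  qed
  then show ?case using Suc.IH by simp
qed simp

lemma sum_shift_eq:
  fixes \<phi> :: "'a::ab_group_add \<Rightarrow> real"
  assumes "finite B" "(\<lambda>s. s + x) ` S \<subseteq> B" "\<And>y. y \<notin> S \<Longrightarrow> \<phi> y = 0"
  shows "(\<Sum>b\<in>B. \<phi> (b - x)) = sum \<phi> S"
proof -
  have "(\<Sum>b\<in>B. \<phi> (b - x)) = (\<Sum>b\<in>(\<lambda>s. s + x) ` S. \<phi> (b - x))"
  proof (rule sum.mono_neutral_right)
    show "\<forall>b\<in>B - (\<lambda>s. s + x) ` S. \<phi> (b - x) = 0"
    proof
      fix b assume b: "b \<in> B - (\<lambda>s. s + x) ` S"
      have "b - x \<notin> S"
      proof
        assume "b - x \<in> S"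
        then have "(b - x) + x \<in> (\<lambda>s. s + x) ` S" by (rule imageI)
        then show False using b by simp
      qed
      then show "\<phi> (b - x) = 0" by (rule assms)
    qed
  qed (use assms in auto)
  also have "\<dots> = sum \<phi> S" by (simp add: sum.reindex inj_on_def)
  finally show ?thesis .
qed

lemma sum_rep:
  assumes fA: "finite A"
  shows "(\<Sum>x\<in>sumset k A. rep k A x) = real (card A) ^ k"
proof (induction k)
  case (Suc k)
  have "(\<Sum>x\<in>sumset (Suc k) A. rep (Suc k) A x) = (\<Sum>a\<in>A. \<Sum>x\<in>sumset (Suc k) A. rep k A (x - a))"
    by (simp add: sum.swap[of _ A])
  also have "\<dots> = (\<Sum>a\<in>A. \<Sum>x\<in>sumset k A. rep k A x)"
    by (intro sum.cong refl sum_shift_eq finite_sumset fA rep_eq_0)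
      (auto simp: sumset_Suc intro: set_plus_intro)
  finally show ?case using Suc.IH by simp
qed simp

text \<open>Associativity of convolution, by induction on \<open>j\<close>; the sum may be cut to
  \<open>sumset k A\<close> since \<open>rep k A\<close> vanishes elsewhere.\<close>

lemma rep_add:
  assumes fA: "finite A"
  shows "rep (j + k) A x = (\<Sum>c\<in>sumset k A. rep k A c * rep j A (x - c))"
proof (induction j arbitrary: x)
  case 0
  have "(\<Sum>c\<in>sumset k A. rep k A c * rep 0 A (x - c)) = (\<Sum>c\<in>sumset k A. if x = c then rep k A c else 0)"
    by (rule sum.cong) auto
  also have "\<dots> = rep k A x" using fA by (auto simp: finite_sumset rep_eq_0)
  finally show ?case by simp
next
  case (Suc j)
  have "rep (Suc j + k) A x = (\<Sum>a\<in>A. \<Sum>c\<in>sumset k A. rep k A c * rep j A (x - a - c))"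
    by (simp add: Suc.IH)
  also have "\<dots> = (\<Sum>c\<in>sumset k A. \<Sum>a\<in>A. rep k A c * rep j A (x - a - c))"
    by (rule sum.swap)
  finally show ?case by (simp add: sum_distrib_left algebra_simps)
qed

text \<open>Splitting off the last entry \<open>y\<close> of a tuple reproduces the recursion of
  \<open>rep\<close>.\<close>

lemma rep_eq_card:
  assumes fA: "finite A"
  shows "rep k A x = real (card {a \<in> {..<k} \<rightarrow>\<^sub>E A. (\<Sum>i<k. a i) = x})"
proof (induction k arbitrary: x)
  case 0
  show ?case by auto
next
  case (Suc k)
  have "bij_betw (\<lambda>(y, g). g(k := y)) (SIGMA y:A. {a \<in> {..<k} \<rightarrow>\<^sub>E A. (\<Sum>i<k. a i) = x - y})
      {a \<in> {..<Suc k} \<rightarrow>\<^sub>E A. (\<Sum>i<Suc k. a i) = x}"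
  proof (rule bij_betwI[where g = "\<lambda>a. (a k, restrict a {..<k})"])
    show "(\<lambda>(y, g). g(k := y)) \<in> (SIGMA y:A. {a \<in> {..<k} \<rightarrow>\<^sub>E A. (\<Sum>i<k. a i) = x - y})
        \<rightarrow> {a \<in> {..<Suc k} \<rightarrow>\<^sub>E A. (\<Sum>i<Suc k. a i) = x}"
      by (auto simp: PiE_def extensional_def Pi_iff less_Suc_eq)
    show "(\<lambda>a. (a k, restrict a {..<k})) \<in> {a \<in> {..<Suc k} \<rightarrow>\<^sub>E A. (\<Sum>i<Suc k. a i) = x}
        \<rightarrow> (SIGMA y:A. {a \<in> {..<k} \<rightarrow>\<^sub>E A. (\<Sum>i<k. a i) = x - y})"
    proof (rule funcsetI)
      fix a assume "a \<in> {a \<in> {..<Suc k} \<rightarrow>\<^sub>E A. (\<Sum>i<Suc k. a i) = x}"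
      then have a: "\<forall>i<Suc k. a i \<in> A" "(\<Sum>i<k. a i) + a k = x" by (auto simp: PiE_iff)
      have "(\<Sum>i<k. restrict a {..<k} i) = (\<Sum>i<k. a i)" by (rule sum.cong) auto
      then have "(\<Sum>i<k. restrict a {..<k} i) = x - a k" using a(2) by linarith
      moreover have "a k \<in> A" "restrict a {..<k} \<in> {..<k} \<rightarrow>\<^sub>E A"
        using a(1) by (simp_all add: PiE_iff)
      ultimately show "(a k, restrict a {..<k})
          \<in> (SIGMA y:A. {a \<in> {..<k} \<rightarrow>\<^sub>E A. (\<Sum>i<k. a i) = x - y})" by blast
    qed
  next
    fix p assume "p \<in> (SIGMA y:A. {a \<in> {..<k} \<rightarrow>\<^sub>E A. (\<Sum>i<k. a i) = x - y})"
    then show "(\<lambda>a. (a k, restrict a {..<k})) ((\<lambda>(y, g). g(k := y)) p) = p"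
      by (auto simp: PiE_def extensional_def restrict_def fun_eq_iff)
  next
    fix a assume "a \<in> {a \<in> {..<Suc k} \<rightarrow>\<^sub>E A. (\<Sum>i<Suc k. a i) = x}"
    then show "(\<lambda>(y, g). g(k := y)) ((\<lambda>a. (a k, restrict a {..<k})) a) = a"
      by (auto simp: PiE_def extensional_def restrict_def fun_eq_iff)
  qed
  then have "card {a \<in> {..<Suc k} \<rightarrow>\<^sub>E A. (\<Sum>i<Suc k. a i) = x}
      = card (SIGMA y:A. {a \<in> {..<k} \<rightarrow>\<^sub>E A. (\<Sum>i<k. a i) = x - y})"
    by (rule bij_betw_same_card[symmetric])
  also have "\<dots> = (\<Sum>y\<in>A. card {a \<in> {..<k} \<rightarrow>\<^sub>E A. (\<Sum>i<k. a i) = x - y})"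
    by (rule card_SigmaI) (use fA in \<open>auto intro!: finite_PiE\<close>)
  finally show ?case by (simp add: Suc.IH)
qed

text \<open>The tuples counted by the energy are grouped by the common sum \<open>x\<close> of their
  two halves; each half ranges independently over \<open>F x\<close>.\<close>

lemma energy_eq_l2mass:
  assumes fA: "finite A"
  shows "real (energy s A) = l2mass s A"
proof -
  define F where "F x = {a \<in> {..<s} \<rightarrow>\<^sub>E A. (\<Sum>i<s. a i) = x}" for x
  have fF: "finite (F x)" for x using fA by (auto simp: F_def intro!: finite_PiE)
  have shift: "(\<Sum>i=s..<2 * s. a i) = (\<Sum>i<s. a (i + s))" for a :: "nat \<Rightarrow> real"
    using sum.shift_bounds_nat_ivl[of a 0 s s] by (simp add: mult_2 atLeast0LessThan)
  let ?E = "{a \<in> {..<2 * s} \<rightarrow>\<^sub>E A. (\<Sum>i<s. a i) = (\<Sum>i=s..<2 * s. a i)}"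
  let ?S = "SIGMA x:sumset s A. F x \<times> F x"
  \<comment> \<open>The second half is re-indexed from 0. Each \<open>restrict\<close> resets values
    outside the index range to \<open>undefined\<close>, as extensional tuples require.\<close>
  let ?to = "\<lambda>a::nat \<Rightarrow> real. (\<Sum>i<s. a i, restrict a {..<s}, restrict (\<lambda>i. a (i + s)) {..<s})"
  let ?from = "\<lambda>(x::real, b::nat \<Rightarrow> real, c). restrict (\<lambda>i. if i < s then b i else c (i - s)) {..<2 * s}"
  have "bij_betw ?to ?E ?S"
  proof (rule bij_betwI[where g = ?from])
    show "?to \<in> ?E \<rightarrow> ?S"
      by (auto simp: F_def shift PiE_def Pi_def sumset_def)
    show "?from \<in> ?S \<rightarrow> ?E"
    proof (rule funcsetI)
      fix p assume "p \<in> ?S"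
      then obtain x b c where p: "p = (x, b, c)" and b: "b \<in> F x" and c: "c \<in> F x" by auto
      have "(\<Sum>i<s. ?from (x, b, c) i) = (\<Sum>i<s. b i)" by (rule sum.cong) auto
      moreover have "(\<Sum>i<s. ?from (x, b, c) (i + s)) = (\<Sum>i<s. c i)" by (rule sum.cong) auto
      moreover have "?from (x, b, c) \<in> {..<2 * s} \<rightarrow>\<^sub>E A"
        using b c by (auto simp: F_def PiE_def Pi_def)
      ultimately show "?from p \<in> ?E"
        unfolding p mem_Collect_eq shift using b c by (simp add: F_def)
    qed
  next
    fix a assume "a \<in> ?E"
    then show "?from (?to a) = a"
      by (auto simp: PiE_def extensional_def fun_eq_iff)
  next
    fix p assume "p \<in> ?S"
    then obtain x b c where p: "p = (x, b, c)" "b \<in> F x" "c \<in> F x" by auto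
    have "(\<Sum>i<s. ?from (x, b, c) i) = (\<Sum>i<s. b i)" by (rule sum.cong) auto
    then show "?to (?from p) = p"
      using p by (auto simp: F_def PiE_def extensional_def fun_eq_iff)
  qed
  then have "energy s A = card ?S"
    unfolding energy_def by (rule bij_betw_same_card)
  also have "\<dots> = (\<Sum>x\<in>sumset s A. card (F x \<times> F x))"
    by (rule card_SigmaI) (use fA fF in \<open>auto simp: finite_sumset\<close>)
  finally show ?thesis
    by (simp add: l2mass_def rep_eq_card[OF fA] F_def power2_eq_square card_cartesian_product)
qed

text \<open>Cauchy--Schwarz over the |A| shifts gives one factor |A|; summing the shifted squares
  gives the other.\<close>

lemma l2mass_Suc_le:
  assumes fA: "finite A"
  shows "l2mass (Suc k) A \<le> (real (card A))\<^sup>2 * l2mass k A"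
proof -
  have "l2mass (Suc k) A \<le> (\<Sum>x\<in>sumset (Suc k) A. real (card A) * (\<Sum>a\<in>A. (rep k A (x - a))\<^sup>2))"
    unfolding l2mass_def rep.simps
    by (rule sum_mono) (metis mult.commute sum_squared_le_sum_of_squares)
  also have "\<dots> = real (card A) * (\<Sum>a\<in>A. \<Sum>x\<in>sumset (Suc k) A. (rep k A (x - a))\<^sup>2)"
    by (simp add: sum_distrib_left sum.swap[of _ A])
  also have "\<dots> \<le> real (card A) * (\<Sum>a\<in>A. l2mass k A)"
    unfolding l2mass_def
    by (intro mult_left_mono sum_mono sum_shift_le) (use fA in \<open>auto simp: finite_sumset rep_eq_0\<close>)
  finally show ?thesis by (simp add: power2_eq_square mult.assoc)
qed

text \<open>One factor of the squared self-convolution is expanded, \<open>b = x - c\<close> is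
  substituted, and then the other factor is expanded. The result is the quadruple sum to which
  \<open>small_doubling_of_flattening_failure\<close> applies.\<close>

lemma l2mass_double:
  assumes fA: "finite A"
  shows "l2mass (2 * k) A = (\<Sum>a\<in>sumset k A. \<Sum>c\<in>sumset k A. \<Sum>b\<in>sumset k A.
    rep k A a * rep k A c * rep k A b * rep k A (b - (a - c)))"
proof -
  let ?S = "sumset k A" and ?f = "rep k A" and ?g = "rep (2 * k) A"
  have g: "?g x = (\<Sum>a\<in>?S. ?f a * ?f (x - a))" for x
    using rep_add[OF fA, of k k x] by (simp add: mult_2)
  have "l2mass (2 * k) A = (\<Sum>x\<in>sumset (2 * k) A. \<Sum>c\<in>?S. ?f c * ?f (x - c) * ?g x)"
    unfolding l2mass_def power2_eq_square by (subst (1) g) (simp add: sum_distrib_right)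
  also have "\<dots> = (\<Sum>c\<in>?S. \<Sum>x\<in>sumset (2 * k) A. ?f c * ?f (x - c) * ?g ((x - c) + c))"
    by (subst sum.swap) simp
  also have "\<dots> = (\<Sum>c\<in>?S. \<Sum>b\<in>?S. ?f c * ?f b * ?g (b + c))"
    by (intro sum.cong refl sum_shift_eq[where \<phi> = "\<lambda>y. ?f c * ?f y * ?g (y + c)" for c])
      (auto simp: finite_sumset fA rep_eq_0 sumset_add_mem mult_2)
  also have "\<dots> = (\<Sum>c\<in>?S. \<Sum>b\<in>?S. \<Sum>a\<in>?S. ?f a * ?f c * ?f b * ?f (b - (a - c)))"
    unfolding g sum_distrib_left by (intro sum.cong refl) (simp add: algebra_simps)
  also have "\<dots> = (\<Sum>c\<in>?S. \<Sum>a\<in>?S. \<Sum>b\<in>?S. ?f a * ?f c * ?f b * ?f (b - (a - c)))"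
    by (rule sum.cong[OF refl], rule sum.swap)
  also have "\<dots> = (\<Sum>a\<in>?S. \<Sum>c\<in>?S. \<Sum>b\<in>?S. ?f a * ?f c * ?f b * ?f (b - (a - c)))"
    by (rule sum.swap)
  finally show ?thesis .
qed

lemma sumset_nonempty: "A \<noteq> {} \<Longrightarrow> sumset k A \<noteq> {}"
  by (induction k) (auto simp: sumset_Suc set_plus_def)

lemma rep_1: "finite A \<Longrightarrow> rep (Suc 0) A x = of_bool (x \<in> A)"
proof -
  assume fA: "finite A"
  have "rep (Suc 0) A x = (\<Sum>a\<in>A. if x = a then 1 else 0)"
    unfolding rep.simps by (rule sum.cong) auto
  then show ?thesis using fA by simp
qed

text \<open>Splitting off one copy of \<open>A\<close> writes the left side as a sum of |(A + c)
  \<inter> V| with weights \<open>rep k A c\<close> of total |A|^k, and the best \<open>c\<close> is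
  at least the average.\<close>

lemma exists_large_translate:
  assumes fA: "finite A" and ne: "A \<noteq> {}" and fV: "finite V"
  obtains y where "(\<Sum>x\<in>V. rep (Suc k) A x) \<le> real (card A) ^ k * real (card (translate A y \<inter> V))"
proof -
  let ?S = "sumset k A" and ?c = "\<lambda>y. card (translate A y \<inter> V)"
  have S: "finite ?S" "?S \<noteq> {}" using fA ne by (auto simp: finite_sumset sumset_nonempty)
  have "Max (?c ` ?S) \<in> ?c ` ?S" using S by (intro Max_in) auto
  then obtain y where y: "?c y = Max (?c ` ?S)" by auto
  have "(\<Sum>x\<in>V. rep (Suc k) A x) = (\<Sum>x\<in>V. \<Sum>c\<in>?S. rep k A c * of_bool (x - c \<in> A))"
    using rep_add[OF fA, of "Suc 0" k] by (simp add: rep_1[OF fA] del: rep.simps)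
  also have "\<dots> = (\<Sum>c\<in>?S. rep k A c * (\<Sum>x\<in>V. of_bool (x - c \<in> A)))"
    by (subst sum.swap) (simp add: sum_distrib_left)
  also have "\<dots> = (\<Sum>c\<in>?S. rep k A c * real (?c c))"
  proof (intro sum.cong refl arg_cong2[of _ _ _ _ "(*)"])
    fix c
    have "translate A c \<inter> V = V \<inter> {x. x - c \<in> A}"
      by (force simp: translate_def)
    then show "(\<Sum>x\<in>V. of_bool (x - c \<in> A)) = real (?c c)"
      using fV by (simp add: of_bool_def sum.If_cases)
  qed
  also have "\<dots> \<le> (\<Sum>c\<in>?S. rep k A c * real (?c y))"
    using S y by (intro sum_mono mult_left_mono rep_nonneg) auto
  also have "\<dots> = real (card A) ^ k * real (?c y)"
    by (simp add: sum_distrib_right[symmetric] sum_rep fA)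
  finally show ?thesis using that by blast
qed

section \<open>Normalised L^2 norms and the choice of a scale\<close>

text \<open>The squared \<open>L\<^sup>2\<close> norm of the \<open>k\<close>-fold convolution of the uniform probability measure on \<open>A\<close>.\<close>

definition conv_l2_sq :: "nat \<Rightarrow> real set \<Rightarrow> real" where
  "conv_l2_sq k A = l2mass k A / real (card A) ^ (2 * k)"

lemma conv_l2_sq_antimono:
  assumes fA: "finite A" and ne: "A \<noteq> {}" and "j \<le> k"
  shows "conv_l2_sq k A \<le> conv_l2_sq j A"
  using \<open>j \<le> k\<close>
proof (induction k rule: dec_induct)
  case (step k)
  have A0: "real (card A) > 0" using fA ne by (simp add: card_gt_0_iff)
  have "conv_l2_sq (Suc k) A \<le> (real (card A))\<^sup>2 * l2mass k A / real (card A) ^ (2 * Suc k)"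
    unfolding conv_l2_sq_def by (rule divide_right_mono[OF l2mass_Suc_le[OF fA]]) simp
  also have "\<dots> = conv_l2_sq k A" using A0 by (simp add: conv_l2_sq_def power2_eq_square)
  finally show ?case using step.IH by linarith
qed simp

lemma sumset_1: "sumset (Suc 0) A = A"
  by (auto simp: sumset_Suc set_plus_def)

lemma conv_l2_sq_1:
  assumes fA: "finite A"
  shows "conv_l2_sq (Suc 0) A = 1 / real (card A)"
  using fA by (simp add: conv_l2_sq_def l2mass_def sumset_1 rep_1 power2_eq_square of_bool_def sum.If_cases
      del: rep.simps)

text \<open>Dividing \<open>rep k A\<close> by |A|^k makes it a probability density, and
  \<open>l2mass_double\<close> turns the flatness hypothesis into the energy hypothesis on that
  density.\<close>

lemma small_doubling_at_flat_scale:
  fixes L :: real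
  assumes fA: "finite A" and ne: "A \<noteq> {}" and L: "L \<ge> 1"
    and flat: "conv_l2_sq (2 * k) A \<ge> conv_l2_sq k A / L"
  obtains V where "V \<subseteq> sumset k A" "V \<noteq> {}" "real (card V) \<le> 1 / conv_l2_sq k A"
    "(\<Sum>x\<in>V. rep k A x) \<ge> real (card A) ^ k / (2 ^ 281 * L ^ 71)"
    "real (card (V + uminus ` V)) \<le> 2 ^ 281 * L ^ 71 * real (card V)"
proof -
  define n where "n = real (card A) ^ k"
  have n0: "n > 0" using fA ne by (simp add: n_def card_gt_0_iff)
  define f where "f x = rep k A x / n" for x
  have mass: "sum f (sumset k A) = 1"
    using sum_rep[OF fA, of k] n0 by (simp add: f_def sum_divide_distrib[symmetric] n_def)
  have Q: "conv_l2_sq k A = (\<Sum>x\<in>sumset k A. (f x)\<^sup>2)"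
    by (simp add: conv_l2_sq_def l2mass_def f_def n_def power_divide sum_divide_distrib[symmetric]
        power_mult[symmetric] mult.commute)
  have "(\<Sum>a\<in>sumset k A. \<Sum>c\<in>sumset k A. \<Sum>b\<in>sumset k A. f a * f c * f b * f (b - (a - c)))
      = l2mass (2 * k) A / n ^ 4"
    unfolding l2mass_double[OF fA] sum_divide_distrib f_def by (simp add: power4_eq_xxxx)
  also have "\<dots> = conv_l2_sq (2 * k) A"
    by (simp add: conv_l2_sq_def n_def power_mult[symmetric] mult.commute mult.left_commute)
  finally have T: "conv_l2_sq k A / L
      \<le> (\<Sum>a\<in>sumset k A. \<Sum>c\<in>sumset k A. \<Sum>b\<in>sumset k A. f a * f c * f b * f (b - (a - c)))"
    using flat by simp
  obtain V where V: "V \<subseteq> sumset k A" "V \<noteq> {}" "real (card V) \<le> 1 / conv_l2_sq k A"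
      "sum f V \<ge> 1 / (2 ^ 281 * L ^ 71)"
      "real (card (V + uminus ` V)) \<le> 2 ^ 281 * L ^ 71 * real (card V)"
  proof (rule small_doubling_of_flattening_failure[OF finite_sumset[OF fA] _ _ mass Q L T])
    show "f x \<ge> 0" for x using n0 by (simp add: f_def rep_nonneg)
    show "x \<notin> sumset k A \<Longrightarrow> f x = 0" for x by (simp add: f_def rep_eq_0)
  qed (rule that)
  have "(\<Sum>x\<in>V. rep k A x) = n * sum f V"
    using n0 by (simp add: f_def sum_distrib_left)
  moreover have "n * (1 / (2 ^ 281 * L ^ 71)) \<le> n * sum f V"
    using V(4) n0 by (intro mult_left_mono) auto
  ultimately have "(\<Sum>x\<in>V. rep k A x) \<ge> n / (2 ^ 281 * L ^ 71)" by simp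
  then show ?thesis using that[OF V(1-3) _ V(5)] by (simp add: n_def)
qed

text \<open>Pigeonhole: if each of the \<open>t\<close> doublings lost more than the factor
  \<open>L\<close>, the norm would fall from 1/|A| by more than \<open>L ^ t = K\<close>,
  contradicting \<open>last\<close>.\<close>

lemma exists_flat_scale:
  fixes K :: real
  assumes fA: "finite A" and ne: "A \<noteq> {}" and K: "K \<ge> 1" and t: "t > 0"
    and last: "conv_l2_sq (2 ^ t) A \<ge> 1 / (K * real (card A))"
  obtains j where "j < t" "conv_l2_sq (2 ^ Suc j) A \<ge> conv_l2_sq (2 ^ j) A / K powr (1 / real t)"
proof -
  define L where "L = K powr (1 / real t)"
  have L0: "L > 0" using K by (simp add: L_def)
  have Lt: "L ^ t = K" using K t by (simp add: L_def powr_realpow[symmetric] powr_powr)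
  have A0: "real (card A) > 0" using fA ne by (simp add: card_gt_0_iff)
  have "\<exists>j<t. conv_l2_sq (2 ^ Suc j) A \<ge> conv_l2_sq (2 ^ j) A / L"
  proof (rule ccontr)
    assume "\<not> ?thesis"
    then have drop: "conv_l2_sq (2 ^ Suc j) A < conv_l2_sq (2 ^ j) A / L" if "j < t" for j
      using that by force
    \<comment> \<open>Phrased with \<open>Suc i\<close> because the inequality becomes strict only
      after one doubling; \<open>t > 0\<close> allows \<open>i = t - 1\<close>.\<close>
    have "conv_l2_sq (2 ^ Suc i) A < conv_l2_sq 1 A / L ^ Suc i" if "i < t" for i
      using that
    proof (induction i)
      case 0
      then show ?case using drop[of 0] by simp
    next
      case (Suc i)
      have "conv_l2_sq (2 ^ Suc (Suc i)) A < conv_l2_sq (2 ^ Suc i) A / L" using drop Suc.prems by blast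
      also have "\<dots> < conv_l2_sq 1 A / L ^ Suc i / L"
        using Suc L0 by (intro divide_strict_right_mono) auto
      finally show ?case by (simp add: mult_ac)
    qed
    from this[of "t - 1"] have "conv_l2_sq (2 ^ t) A < conv_l2_sq 1 A / L ^ t" using t by simp
    then show False using last conv_l2_sq_1[OF fA] by (simp add: Lt mult.commute)
  qed
  then show ?thesis using that by (auto simp: L_def)
qed

section \<open>Small doubling and a large translate at the flat scale\<close>

theorem theorem6p2:
  "\<exists>(C::real) > 0. \<exists>(c1::real) > 0. \<exists>(c2::real) > 0. \<exists>c :: nat \<Rightarrow> nat \<Rightarrow> real.
     (\<forall>m n. c m n > 0) \<and>
     (\<forall>(A::real set) (s::nat) (K::real).
        finite A \<and> A \<noteq> {} \<and> s \<ge> 2 \<and> K \<ge> 1 \<and>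
        real (energy s A) = real (card A) ^ (2 * s - 1) / K \<longrightarrow>
        (\<exists>(s'::nat) (U::real set).
           2 \<le> s' \<and> s' \<le> s \<and> finite U \<and> U \<noteq> {} \<and> U \<subseteq> sumset s' A \<and>
           real (card U) \<le> c1 * (K * real (card A)) \<and>
           real (Max ((\<lambda>x. card (translate A x \<inter> U)) ` diffset U A))
             \<ge> c2 * (real (card A) / K powr (C / log 2 (real s))) \<and>
           (\<forall>m n :: nat.
              real (card (sumdiffset m n U))
                \<le> c m n * (K powr (C * real (m + n) / log 2 (real s)) * real (card U)))))"
proof -
  define B :: real where "B = 2 ^ 281"
  have B0: "B > 0" by (simp add: B_def)
  have main: "\<exists>(s'::nat) (U::real set).
           2 \<le> s' \<and> s' \<le> s \<and> finite U \<and> U \<noteq> {} \<and> U \<subseteq> sumset s' A \<and>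
           real (card U) \<le> 1 * (K * real (card A)) \<and>
           real (Max ((\<lambda>x. card (translate A x \<inter> U)) ` diffset U A))
             \<ge> (1 / B) * (real (card A) / K powr (142 / log 2 (real s))) \<and>
           (\<forall>m n :: nat.
              real (card (sumdiffset m n U))
                \<le> B ^ (m + n) * (K powr (142 * real (m + n) / log 2 (real s)) * real (card U)))"
    if fA: "finite A" and ne: "A \<noteq> {}" and s: "s \<ge> 2" and K: "K \<ge> 1"
      and E: "real (energy s A) = real (card A) ^ (2 * s - 1) / K" for A s K
  proof -
    have A0: "real (card A) > 0" using fA ne by (simp add: card_gt_0_iff)
    \<comment> \<open>\<open>t\<close> is the integer part of the binary logarithm of
      \<open>s\<close>; it is positive because \<open>s \<ge> 2\<close>.\<close>
    obtain t where t: "2 ^ t \<le> s" "s < 2 ^ (t + 1)" using ex_power_ivl1[of 2 s] s by auto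
    have t0: "t > 0" using t s by (cases t) auto
    define L where "L = K powr (1 / real t)"
    have L: "L \<ge> 1" using K by (simp add: L_def ge_one_powr_ge_zero)
    have flat_s: "conv_l2_sq s A = 1 / (K * real (card A))"
    proof -
      have "real (card A) ^ (2 * s) = real (card A) * real (card A) ^ (2 * s - 1)"
        using s by (simp flip: power_Suc)
      then show ?thesis
        using A0 K by (simp add: conv_l2_sq_def energy_eq_l2mass[OF fA, symmetric] E)
    qed
    have "conv_l2_sq (2 ^ t) A \<ge> 1 / (K * real (card A))"
      using conv_l2_sq_antimono[OF fA ne t(1)] by (simp add: flat_s)
    then obtain j where j: "j < t" "conv_l2_sq (2 ^ Suc j) A \<ge> conv_l2_sq (2 ^ j) A / L"
      using exists_flat_scale[OF fA ne K t0] unfolding L_def by blast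
    define k where "k = (2::nat) ^ j"
    have k1: "k \<ge> 1" by (simp add: k_def)
    have "2 * k \<le> 2 ^ t" unfolding k_def power_Suc[symmetric] using j by (intro power_increasing) auto
    then have ks: "2 * k \<le> s" using t by linarith
    have flat: "conv_l2_sq (2 * k) A \<ge> conv_l2_sq k A / L" using j by (simp add: k_def)
    obtain V where V: "V \<subseteq> sumset k A" "V \<noteq> {}" "real (card V) \<le> 1 / conv_l2_sq k A"
        "(\<Sum>x\<in>V. rep k A x) \<ge> real (card A) ^ k / (B * L ^ 71)"
        "real (card (V + uminus ` V)) \<le> B * L ^ 71 * real (card V)"
      using small_doubling_at_flat_scale[OF fA ne L flat] unfolding B_def by blast
    have fV: "finite V" using V(1) finite_sumset[OF fA] finite_subset by blast
    obtain y where "(\<Sum>x\<in>V. rep (Suc (k - 1)) A x)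
        \<le> real (card A) ^ (k - 1) * real (card (translate A y \<inter> V))"
      by (rule exists_large_translate[OF fA ne fV])
    then have "real (card A) ^ k / (B * L ^ 71)
        \<le> real (card A) ^ (k - 1) * real (card (translate A y \<inter> V))"
      using V(4) k1 by simp
    moreover have "real (card A) ^ k = real (card A) ^ (k - 1) * real (card A)"
      using k1 by (simp flip: power_Suc2)
    ultimately have "real (card A) ^ (k - 1) * (real (card A) / (B * L ^ 71))
        \<le> real (card A) ^ (k - 1) * real (card (translate A y \<inter> V))" by simp
    then have y: "real (card A) / (B * L ^ 71) \<le> real (card (translate A y \<inter> V))"
      using A0 by (simp only: mult_le_cancel_left_pos zero_less_power)

    have log: "0 < log 2 (real s)" "log 2 (real s) \<le> 2 * real t"
    proof -
      show "0 < log 2 (real s)" using s by simp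
      have "real s \<le> real (2 ^ (t + 1))" using t(2) by (intro of_nat_mono) simp
      then have "log 2 (real s) \<le> log 2 (2 ^ (t + 1))" using s by (intro log_mono) auto
      also have "\<dots> = real t + 1" by (simp add: log_nat_power del: power_Suc)
      finally show "log 2 (real s) \<le> 2 * real t" using t0 by linarith
    qed
    \<comment> \<open>The exponent 142 is twice 71: the power of \<open>L\<close> costs 71/t in the
      exponent of \<open>K\<close>, and log s \<le> t + 1 \<le> 2t replaces 1/t by 2/log s.\<close>
    have Lpow: "L ^ (71 * i) \<le> K powr (142 * real i / log 2 (real s))" for i
    proof -
      have "L ^ (71 * i) = K powr (71 * real i / real t)"
        using K by (simp add: L_def powr_realpow[symmetric] powr_powr)
      also have "\<dots> \<le> K powr (142 * real i / log 2 (real s))"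
      proof (rule powr_mono[OF _ K])
        have "71 * real i / real t = 142 * real i / (2 * real t)" by simp
        also have "\<dots> \<le> 142 * real i / log 2 (real s)"
          using log t0 by (intro divide_left_mono) auto
        finally show "71 * real i / real t \<le> 142 * real i / log 2 (real s)" .
      qed
      finally show ?thesis .
    qed

    \<comment> \<open>The scale \<open>k\<close> may be \<open>1\<close>; translating by an element of \<open>A\<close> moves \<open>V\<close> into \<open>(k + 1)A\<close>, and
      \<open>2 \<le> k + 1 \<le> 2k \<le> s\<close>.\<close>
    obtain a where a: "a \<in> A" using ne by blast
    define U where "U = (\<lambda>x. x + a) ` V"
    have cardU: "card U = card V" by (simp add: U_def card_image)
    have fU: "finite U" using fV by (simp add: U_def)
    have Une: "U \<noteq> {}" using V by (simp add: U_def)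
    have UU: "U + uminus ` U = V + uminus ` V"
      by (force simp: U_def set_plus_def)
    have "U \<subseteq> sumset (Suc k) A"
      unfolding sumset_Suc using V(1) a by (auto simp: U_def intro: set_plus_intro)
    moreover have "real (card U) \<le> 1 * (K * real (card A))"
    proof -
      have "1 / (K * real (card A)) \<le> conv_l2_sq k A"
        using conv_l2_sq_antimono[OF fA ne, of k s] ks by (simp add: flat_s)
      then have "1 / conv_l2_sq k A \<le> 1 / (1 / (K * real (card A)))"
        using K A0 by (intro frac_le) auto
      then show ?thesis using V(3) cardU by simp
    qed
    moreover have "(1 / B) * (real (card A) / K powr (142 / log 2 (real s)))
        \<le> real (Max ((\<lambda>x. card (translate A x \<inter> U)) ` diffset U A))"
    proof -
      have shift: "translate A (y + a) \<inter> U = (\<lambda>x. x + a) ` (translate A y \<inter> V)"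
        by (force simp: translate_def U_def)
      then have card_shift: "card (translate A (y + a) \<inter> U) = card (translate A y \<inter> V)"
        by (simp add: card_image)
      \<comment> \<open>Positivity makes the intersection nonempty, and a common point exhibits the
        shift \<open>y + a\<close> as an element of U - A, the range of the maximum.\<close>
      have "real (card A) / (B * L ^ 71) > 0" using A0 B0 L by simp
      then have "translate A y \<inter> V \<noteq> {}" using y by auto
      then obtain u where u: "u \<in> U" "u \<in> translate A (y + a)" using shift by blast
      then obtain b where "b \<in> A" "u = b + (y + a)" by (auto simp: translate_def)
      then have "y + a = u - b" by simp
      then have mem: "y + a \<in> diffset U A" using u \<open>b \<in> A\<close> unfolding diffset_def by blast
      have fD: "finite (diffset U A)"
        unfolding diffset_def using fU fA by (intro finite_image_set2) auto
      have "(1 / B) * (real (card A) / K powr (142 / log 2 (real s))) \<le> (1 / B) * (real (card A) / L ^ 71)"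
        using Lpow[of 1] A0 B0 L by (intro mult_left_mono frac_le) auto
      also have "\<dots> \<le> real (card (translate A (y + a) \<inter> U))" using y card_shift by simp
      also have "\<dots> \<le> real (Max ((\<lambda>x. card (translate A x \<inter> U)) ` diffset U A))"
        using fD mem by (intro of_nat_mono Max_ge) auto
      finally show ?thesis .
    qed
    moreover have "real (card (sumdiffset m n U))
        \<le> B ^ (m + n) * (K powr (142 * real (m + n) / log 2 (real s)) * real (card U))" for m n
    proof -
      have "real (card (sumdiffset m n U)) \<le> (B * L ^ 71) ^ (m + n) * real (card U)"
        using V(5) by (intro pluennecke_ruzsa fU Une) (simp add: UU cardU)
      also have "\<dots> = B ^ (m + n) * (L ^ (71 * (m + n)) * real (card U))"
        unfolding power_mult_distrib power_mult mult.assoc ..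
      also have "\<dots> \<le> B ^ (m + n) * (K powr (142 * real (m + n) / log 2 (real s)) * real (card U))"
        using B0 by (intro mult_left_mono mult_right_mono Lpow) auto
      finally show ?thesis .
    qed
    ultimately show ?thesis
      using k1 ks fU Une by (intro exI[of _ "Suc k"] exI[of _ U]) auto
  qed
  show ?thesis
    by (rule exI[of _ 142], rule conjI, simp, rule exI[of _ 1], rule conjI, simp,
        rule exI[of _ "1 / B"], rule conjI, simp add: B0, rule exI[of _ "\<lambda>m n. B ^ (m + n)"])
      (use B0 main in \<open>auto simp del: of_nat_add\<close>)
qed

end
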